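(* Let $Q$ be a torsion-free fs monoid and let $P$ be a toric submonoid of $Q$ such that $Q\cap(-P)=\{0\}$ (inside $Q^{\mathrm{gp}}$). Then the inclusion $u: P\hookrightarrow Q$ is pseudo-saturated if and only if every $y\in Q_{\mathbb Q_{\ge0}}$ admits a unique minimal decomposition relative to $(P,Q)$.
   Context: All monoids are commutative with identity, written additively. $P^{\mathrm{gp}}$ is the group envelope of $P$. $P$ is integral if $P\to P^{\mathrm{gp}}$ is injective; saturated if it is integral and every $a\in P^{\mathrm{gp}}$ with $na\in P$ for some integer $n\ge1$ lies in $P$; fs if it is saturated and finitely generated; sharp if its only unit is $0$; toric if it is sharp and fs. For $x,x'$ in a monoid $P$, write $x\mid x'$ if $x'=x+x''$ for some $x''\in P$. For a saturated torsion-free monoid $P$ let $P_{\mathbb Q_{\ge0}}=\varinjlim_n \frac1n P$ (colimit over positive integers, ordered by divisibility), viewed inside $P^{\mathrm{gp}}\otimes_{\mathbb Z}\mathbb Q$. A homomorphism $u:P\to Q$ of saturated monoids is pseudo-saturated if there is an integer $M\ge1$ such that for every integer $n\ge1$ and all $x\in P$, $y\in Q$ with $u(x)\mid ny$ in $Q$, there exists $x'\in P$ with $Mx\mid nx'$ in $P$ and $u(x')\mid My$ in $Q$. Minimal decomposition: for $P\subset Q$ as in the claim and $y\in Q_{\mathbb Q_{\ge0}}$, a decomposition $y=y'+x'$ with $y'\in Q_{\mathbb Q_{\ge0}}$ and $x'\in P_{\mathbb Q_{\ge0}}$ is a minimal decomposition of $y$ relative to $(P,Q)$ if for every $x\in P_{\mathbb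 Q_{\ge0}}\setminus\{0\}$ one has $y'-x\notin Q_{\mathbb Q_{\ge0}}$. *)

theory Defs
  imports Complex_Main
begin

text \<open>
  Monoids are submonoids \<open>M\<close> of a type of class \<^class>\<open>comm_monoid_add\<close>; an abstract monoid is
  the case \<^term>\<open>M = UNIV\<close>. All properties of \<open>M\<close> below are intrinsic: they do not depend on
  the part of the type outside \<open>M\<close>.
\<close>

definition add_submonoid :: "'a::comm_monoid_add set \<Rightarrow> bool" where
  "add_submonoid M \<longleftrightarrow> 0 \<in> M \<and> (\<forall>x\<in>M. \<forall>y\<in>M. x + y \<in> M)"

definition nmul :: "nat \<Rightarrow> 'a::comm_monoid_add \<Rightarrow> 'a" where
  "nmul n x = (\<Sum>i<n. x)"

definition mdvd :: "'a::comm_monoid_add set \<Rightarrow> 'a \<Rightarrow> 'a \<Rightarrow> bool" where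
  "mdvd M x x' \<longleftrightarrow> (\<exists>x''\<in>M. x' = x + x'')"


section \<open>The group envelope\<close>

text \<open>
  A pair \<open>(a, b)\<close> stands for the formal difference \<open>a - b\<close>. The summand \<open>k\<close> is needed because
  \<open>M\<close> is not assumed to be cancellative.
\<close>

definition gp_rel :: "'a::comm_monoid_add set \<Rightarrow> (('a \<times> 'a) \<times> ('a \<times> 'a)) set" where
  "gp_rel M = {((a, b), (c, d)).
     a \<in> M \<and> b \<in> M \<and> c \<in> M \<and> d \<in> M \<and> (\<exists>k\<in>M. a + d + k = c + b + k)}"

text \<open>The class of \<open>a - b\<close> in the group envelope \<^term>\<open>(M \<times> M) // gp_rel M\<close> of \<open>M\<close>.\<close>

definition gp_diff :: "'a::comm_monoid_add set \<Rightarrow> 'a \<Rightarrow> 'a \<Rightarrow> ('a \<times> 'a) set" where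
  "gp_diff M a b = gp_rel M `` {(a, b)}"

definition gp_incl :: "'a::comm_monoid_add set \<Rightarrow> 'a \<Rightarrow> ('a \<times> 'a) set" where
  "gp_incl M x = gp_diff M x 0"

lemma gp_rel_trans:
  fixes a b c d e f k l :: "'a::comm_monoid_add"
  assumes "a + d + k = c + b + k" and "c + f + l = e + d + l"
  shows "a + f + (d + k + l) = e + b + (d + k + l)"
proof -
  have "a + f + (d + k + l) = (a + d + k) + f + l"
    by (simp add: ac_simps)
  also have "\<dots> = (c + f + l) + b + k"
    by (simp only: assms(1)) (simp add: ac_simps)
  also have "\<dots> = e + b + (d + k + l)"
    by (simp only: assms(2)) (simp add: ac_simps)
  finally show ?thesis .
qed

lemma equiv_gp_rel:
  assumes "add_submonoid M"
  shows "equiv (M \<times> M) (gp_rel M)"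
proof (rule equivI)
  show "gp_rel M \<subseteq> (M \<times> M) \<times> (M \<times> M)"
    by (auto simp: gp_rel_def)
  show "refl_on (M \<times> M) (gp_rel M)"
    using assms by (auto simp: refl_on_def gp_rel_def add_submonoid_def)
  show "sym (gp_rel M)"
    by (rule symI) (auto simp: gp_rel_def intro: sym)
  show "trans (gp_rel M)"
  proof (rule transI)
    fix p q r assume "(p, q) \<in> gp_rel M" "(q, r) \<in> gp_rel M"
    then obtain a b c d e f k l where
      pqr: "p = (a, b)" "r = (e, f)" "a \<in> M" "b \<in> M" "d \<in> M" "e \<in> M" "f \<in> M" "k \<in> M" "l \<in> M"
      and eqs: "a + d + k = c + b + k" "c + f + l = e + d + l"
      unfolding gp_rel_def by blast
    have "d + k + l \<in> M"
      using assms pqr by (simp add: add_submonoid_def)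
    then show "(p, r) \<in> gp_rel M"
      using gp_rel_trans[OF eqs] pqr unfolding gp_rel_def by blast
  qed
qed


section \<open>Properties of monoids\<close>

definition integral_monoid :: "'a::comm_monoid_add set \<Rightarrow> bool" where
  "integral_monoid M \<longleftrightarrow> inj_on (gp_incl M) M"

text \<open>An element of the group envelope is some \<open>a - b\<close>, and its \<open>n\<close>-fold multiple is \<open>na - nb\<close>.\<close>

definition saturated_monoid :: "'a::comm_monoid_add set \<Rightarrow> bool" where
  "saturated_monoid M \<longleftrightarrow> integral_monoid M \<and>
     (\<forall>a\<in>M. \<forall>b\<in>M. \<forall>n\<ge>1. gp_diff M (nmul n a) (nmul n b) \<in> gp_incl M ` M
        \<longrightarrow> gp_diff M a b \<in> gp_incl M ` M)"

text \<open>As usual for integral monoids, torsion-free means that the group envelope is torsion-free.\<close>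

definition torsion_free_monoid :: "'a::comm_monoid_add set \<Rightarrow> bool" where
  "torsion_free_monoid M \<longleftrightarrow>
     (\<forall>a\<in>M. \<forall>b\<in>M. \<forall>n\<ge>1. gp_diff M (nmul n a) (nmul n b) = gp_incl M 0
        \<longrightarrow> gp_diff M a b = gp_incl M 0)"

definition fg_monoid :: "'a::comm_monoid_add set \<Rightarrow> bool" where
  "fg_monoid M \<longleftrightarrow> (\<exists>S. finite S \<and> M = add_submonoid hull S)"

definition fs_monoid :: "'a::comm_monoid_add set \<Rightarrow> bool" where
  "fs_monoid M \<longleftrightarrow> saturated_monoid M \<and> fg_monoid M"

definition sharp_monoid :: "'a::comm_monoid_add set \<Rightarrow> bool" where
  "sharp_monoid M \<longleftrightarrow> (\<forall>x\<in>M. (\<exists>y\<in>M. x + y = 0) \<longrightarrow> x = 0)"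

definition toric_monoid :: "'a::comm_monoid_add set \<Rightarrow> bool" where
  "toric_monoid M \<longleftrightarrow> sharp_monoid M \<and> fs_monoid M"

text \<open>The notion is meant for a homomorphism \<open>u\<close> between saturated monoids \<open>P\<close> and \<open>Q\<close>.\<close>

definition pseudo_saturated ::
  "'a::comm_monoid_add set \<Rightarrow> 'b::comm_monoid_add set \<Rightarrow> ('a \<Rightarrow> 'b) \<Rightarrow> bool" where
  "pseudo_saturated P Q u \<longleftrightarrow>
     (\<exists>M\<ge>1. \<forall>n\<ge>1. \<forall>x\<in>P. \<forall>y\<in>Q. mdvd Q (u x) (nmul n y) \<longrightarrow>
        (\<exists>x'\<in>P. mdvd P (nmul M x) (nmul n x') \<and> mdvd Q (u x') (nmul M y)))"


section \<open>The group envelope of a type, and its rationalization\<close>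

quotient_type (overloaded) 'a group_envelope =
  "'a::comm_monoid_add \<times> 'a" / "\<lambda>p q. (p, q) \<in> gp_rel UNIV"
proof -
  have "equiv UNIV (gp_rel (UNIV :: 'a set))"
    using equiv_gp_rel[of "UNIV :: 'a set"] by (simp add: add_submonoid_def)
  then show "equivp (\<lambda>p q. (p, q) \<in> gp_rel (UNIV :: 'a set))"
    by (simp add: equivp_equiv)
qed

instantiation group_envelope :: (comm_monoid_add) ab_group_add
begin

lift_definition zero_group_envelope :: "'a group_envelope" is "(0, 0)" .

lift_definition plus_group_envelope ::
  "'a group_envelope \<Rightarrow> 'a group_envelope \<Rightarrow> 'a group_envelope"
  is "\<lambda>(a, b) (c, d). (a + c, b + d)"
proof -
  fix p p' q q' :: "'a \<times> 'a"
  assume "(p, p') \<in> gp_rel UNIV" "(q, q') \<in> gp_rel UNIV"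
  then obtain a b a' b' c d c' d' k l where
    p: "p = (a, b)" "p' = (a', b')" "q = (c, d)" "q' = (c', d')" and
    k: "a + b' + k = a' + b + k" and l: "c + d' + l = c' + d + l"
    by (auto simp: gp_rel_def)
  have "a + c + (b' + d') + (k + l) = (a + b' + k) + (c + d' + l)"
    by (simp add: ac_simps)
  also have "\<dots> = (a' + b + k) + (c' + d + l)"
    by (simp only: k l)
  also have "\<dots> = a' + c' + (b + d) + (k + l)"
    by (simp add: ac_simps)
  finally show "((case p of (a, b) \<Rightarrow> \<lambda>(c, d). (a + c, b + d)) q,
    (case p' of (a, b) \<Rightarrow> \<lambda>(c, d). (a + c, b + d)) q') \<in> gp_rel UNIV"
    unfolding p gp_rel_def by auto
qed

lift_definition uminus_group_envelope :: "'a group_envelope \<Rightarrow> 'a group_envelope"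
  is "\<lambda>(a, b). (b, a)"
  by (auto simp: gp_rel_def, metis add.commute)

definition minus_group_envelope ::
  "'a group_envelope \<Rightarrow> 'a group_envelope \<Rightarrow> 'a group_envelope" where
  "minus_group_envelope x y = x + - y"

instance
proof
  fix a b c :: "'a group_envelope"
  show "a + b + c = a + (b + c)"
    by transfer (auto simp: gp_rel_def ac_simps)
  show "a + b = b + a"
    by transfer (auto simp: gp_rel_def ac_simps)
  show "0 + a = a"
    by transfer (auto simp: gp_rel_def)
  show "- a + a = 0"
    by transfer (auto simp: gp_rel_def ac_simps)
  show "a - b = a + - b"
    by (rule minus_group_envelope_def)
qed

end

lift_definition to_envelope :: "'a::comm_monoid_add \<Rightarrow> 'a group_envelope" is "\<lambda>x. (x, 0)" .

text \<open>
  For an abelian group \<open>A\<close>, the group \<open>A \<otimes> \<rat>\<close> is constructed as the colimit of the groups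
  \<open>(1/n) A\<close> over the positive integers ordered by divisibility, that is, as the localization
  of \<open>A\<close> at the positive integers. A pair \<open>(a, m)\<close> stands for \<open>a / (m + 1)\<close>, so that every
  natural number \<open>m\<close> is allowed.
\<close>

lemma nmul_simps:
  fixes x y :: "'a::comm_monoid_add"
  shows "nmul 0 x = 0" and "nmul (Suc n) x = x + nmul n x" and "nmul n (0::'a) = 0"
    and "nmul n (x + y) = nmul n x + nmul n y"
  by (simp_all add: nmul_def sum.distrib ac_simps)

lemma nmul_add: "nmul (m + n) x = nmul m x + nmul n (x::'a::comm_monoid_add)"
  by (induction m) (simp_all add: nmul_simps ac_simps)

lemma nmul_mult: "nmul (m * n) x = nmul m (nmul n (x::'a::comm_monoid_add))"
  by (induction m) (simp_all add: nmul_simps nmul_add)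

lemma nmul_uminus: "nmul n (- x) = - nmul n (x::'a::ab_group_add)"
  by (induction n) (simp_all add: nmul_simps)

definition frac_eq :: "'a::ab_group_add \<times> nat \<Rightarrow> 'a \<times> nat \<Rightarrow> bool" where
  "frac_eq p q \<longleftrightarrow> (\<exists>k\<ge>1. nmul (k * Suc (snd q)) (fst p) = nmul (k * Suc (snd p)) (fst q))"

lemma equivp_frac_eq: "equivp (frac_eq :: 'a::ab_group_add \<times> nat \<Rightarrow> _)"
proof (rule equivpI)
  show "reflp (frac_eq :: 'a \<times> nat \<Rightarrow> _)"
    by (auto simp: reflp_def frac_eq_def)
  show "symp (frac_eq :: 'a \<times> nat \<Rightarrow> _)"
    unfolding symp_def frac_eq_def by metis
  show "transp (frac_eq :: 'a \<times> nat \<Rightarrow> _)"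
  proof (rule transpI)
    fix p q r :: "'a \<times> nat"
    assume "frac_eq p q" "frac_eq q r"
    then obtain k l where kl: "k \<ge> 1" "l \<ge> 1"
      and k: "nmul (k * Suc (snd q)) (fst p) = nmul (k * Suc (snd p)) (fst q)"
      and l: "nmul (l * Suc (snd r)) (fst q) = nmul (l * Suc (snd q)) (fst r)"
      by (auto simp: frac_eq_def)
    let ?j = "k * l * Suc (snd q)"
    have "nmul (?j * Suc (snd r)) (fst p)
        = nmul (l * Suc (snd r)) (nmul (k * Suc (snd q)) (fst p))"
      by (simp only: nmul_mult[symmetric] ac_simps)
    also have "\<dots> = nmul (k * Suc (snd p)) (nmul (l * Suc (snd r)) (fst q))"
      by (simp only: k) (simp only: nmul_mult[symmetric] ac_simps)
    also have "\<dots> = nmul (?j * Suc (snd p)) (fst r)"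
      by (simp only: l) (simp only: nmul_mult[symmetric] ac_simps)
    finally have "nmul (?j * Suc (snd r)) (fst p) = nmul (?j * Suc (snd p)) (fst r)" .
    moreover have "?j \<ge> 1"
      using kl by (simp add: Suc_le_eq)
    ultimately show "frac_eq p r"
      unfolding frac_eq_def by blast
  qed
qed

quotient_type (overloaded) 'a rationalization = "'a::ab_group_add \<times> nat" / frac_eq
  by (rule equivp_frac_eq)

instantiation rationalization :: (ab_group_add) ab_group_add
begin

lift_definition zero_rationalization :: "'a rationalization" is "(0, 0)" .

lift_definition plus_rationalization ::
  "'a rationalization \<Rightarrow> 'a rationalization \<Rightarrow> 'a rationalization"
  is "\<lambda>(a, m) (b, n). (nmul (Suc n) a + nmul (Suc m) b, Suc m * Suc n - 1)"
proof -
  fix p p' q q' :: "'a \<times> nat"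
  assume "frac_eq p p'" "frac_eq q q'"
  then obtain a m a' m' b n b' n' k l where
    p: "p = (a, m)" "p' = (a', m')" "q = (b, n)" "q' = (b', n')" and kl: "k \<ge> 1" "l \<ge> 1" and
    k: "nmul (k * Suc m') a = nmul (k * Suc m) a'" and
    l: "nmul (l * Suc n') b = nmul (l * Suc n) b'"
    by (cases p, cases p', cases q, cases q') (auto simp: frac_eq_def)
  have 1: "nmul (k * l * (Suc m' * Suc n')) (nmul (Suc n) a)
      = nmul (k * l * (Suc m * Suc n)) (nmul (Suc n') a')"
  proof -
    have "nmul (k * l * (Suc m' * Suc n')) (nmul (Suc n) a)
        = nmul (l * Suc n' * Suc n) (nmul (k * Suc m') a)"
      by (simp only: nmul_mult[symmetric] ac_simps)
    also have "\<dots> = nmul (k * l * (Suc m * Suc n)) (nmul (Suc n') a')"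
      by (simp only: k) (simp only: nmul_mult[symmetric] ac_simps)
    finally show ?thesis .
  qed
  have 2: "nmul (k * l * (Suc m' * Suc n')) (nmul (Suc m) b)
      = nmul (k * l * (Suc m * Suc n)) (nmul (Suc m') b')"
  proof -
    have "nmul (k * l * (Suc m' * Suc n')) (nmul (Suc m) b)
        = nmul (k * Suc m' * Suc m) (nmul (l * Suc n') b)"
      by (simp only: nmul_mult[symmetric] ac_simps)
    also have "\<dots> = nmul (k * l * (Suc m * Suc n)) (nmul (Suc m') b')"
      by (simp only: l) (simp only: nmul_mult[symmetric] ac_simps)
    finally show ?thesis .
  qed
  have S: "Suc (Suc i * Suc j - 1) = Suc i * Suc j" for i j
    by simp
  show "frac_eq
    ((case p of (a, m) \<Rightarrow> \<lambda>(b, n). (nmul (Suc n) a + nmul (Suc m) b, Suc m * Suc n - 1)) q)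
    ((case p' of (a, m) \<Rightarrow> \<lambda>(b, n). (nmul (Suc n) a + nmul (Suc m) b, Suc m * Suc n - 1)) q')"
    unfolding p frac_eq_def prod.case fst_conv snd_conv S nmul_simps(4)
    using kl 1 2 by (intro exI[of _ "k * l"]) simp
qed

lift_definition uminus_rationalization :: "'a rationalization \<Rightarrow> 'a rationalization"
  is "\<lambda>(a, m). (- a, m)"
  by (auto simp: frac_eq_def nmul_uminus)

definition minus_rationalization ::
  "'a rationalization \<Rightarrow> 'a rationalization \<Rightarrow> 'a rationalization" where
  "minus_rationalization x y = x + - y"

instance
proof
  fix a b c :: "'a rationalization"
  have S: "Suc (Suc i * Suc j - 1) = Suc i * Suc j" for i j
    by simp
  have eq: "frac_eq (x, m) (y, n)" if "nmul (Suc n) x = nmul (Suc m) y" for x y :: 'a and m n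
    unfolding frac_eq_def using that by (intro exI[of _ 1]) simp
  show "a + b + c = a + (b + c)"
    by transfer (clarsimp simp only: split: prod.splits, rule eq,
      simp only: S nmul_simps(4) nmul_mult[symmetric] ac_simps)
  show "a + b = b + a"
    by transfer (clarsimp simp only: split: prod.splits, rule eq,
      simp only: S nmul_simps(4) nmul_mult[symmetric] ac_simps)
  show "0 + a = a"
    by transfer (clarsimp split: prod.splits, rule eq, simp add: nmul_simps)
  show "- a + a = 0"
    by transfer (clarsimp split: prod.splits, rule eq, simp add: nmul_simps nmul_uminus)
  show "a - b = a + - b"
    by (rule minus_rationalization_def)
qed

end

text \<open>The element \<open>a / n\<close>, for \<open>n \<ge> 1\<close>.\<close>

lift_definition quotient_by :: "'a::ab_group_add \<Rightarrow> nat \<Rightarrow> 'a rationalization" is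
  "\<lambda>a n. (a, n - 1)" .

section \<open>Minimal decompositions\<close>

text \<open>
  For a submonoid \<open>M\<close> of a torsion-free saturated monoid given by the type \<^typ>\<open>'a\<close>, this is
  the colimit of the monoids \<open>(1/n) M\<close>, as a subset of the rationalized group envelope
  of \<^typ>\<open>'a\<close>.
\<close>

definition rat_cone :: "'a::comm_monoid_add set \<Rightarrow> 'a group_envelope rationalization set" where
  "rat_cone M = {quotient_by (to_envelope x) n | x n. x \<in> M \<and> n \<ge> 1}"

text \<open>The pair \<open>(y', x')\<close> is the decomposition \<open>y = y' + x'\<close>.\<close>

definition minimal_decomposition ::
  "'a::comm_monoid_add set \<Rightarrow> 'a set \<Rightarrow> 'a group_envelope rationalization \<Rightarrow>
   'a group_envelope rationalization \<times> 'a group_envelope rationalization \<Rightarrow> bool" where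
  "minimal_decomposition P Q y = (\<lambda>(y', x').
     y' \<in> rat_cone Q \<and> x' \<in> rat_cone P \<and> y = y' + x' \<and>
     (\<forall>x \<in> rat_cone P - {0}. y' - x \<notin> rat_cone Q))"

end

theory Submission
  imports Defs "HOL-Library.Infinite_Set"
begin

text \<open>
  Minimal decompositions \<open>y = y' + x'\<close> correspond to maximal elements \<open>x'\<close>, for the order of the
  cone of \<open>P\<close>, of the bounded convex set of all \<open>x\<close> in that cone with \<open>y - x\<close> in the cone of \<open>Q\<close>.
  Pseudo-saturation says that the elements of this set with denominator \<open>M\<close> are cofinal in it, for
  one \<open>M\<close> and all \<open>y\<close> in \<open>Q\<close>. Cofinality gives maximal elements, finitely many by Dickson's lemma;
  two of them would be joined by a segment, infinitely many points of which lie below the same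
  maximal element, contradicting maximality of an endpoint. Conversely, if maximal elements are
  unique, then they are greatest, and \<open>y \<mapsto> x'\<close> is additive over each of the finitely many faces
  of \<open>Q\<close> that can contain \<open>y'\<close>. As \<open>Q\<^sup>g\<^sup>p\<close> is finitely generated, the
  denominators of \<open>x'\<close> are bounded.
\<close>

section \<open>Multiples in abelian groups\<close>

lemma nmul_1 [simp]: "nmul (Suc 0) x = x"
  by (simp add: nmul_simps)

lemma nmul_0 [simp]: "nmul 0 x = 0" "nmul n 0 = 0"
  by (simp_all add: nmul_simps)

lemma nmul_diff: "nmul n (x - y) = nmul n x - nmul n (y::'a::ab_group_add)"
  using nmul_simps(4)[of n x "- y"] by (simp add: nmul_uminus)

lemma nmul_left_commute: "nmul m (nmul n x) = nmul n (nmul m x)"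
  by (metis nmul_mult mult.commute)

lemmas nmul_distribs = nmul_simps(4) nmul_diff nmul_uminus

lemma nmul_diff_left:
  "i \<le> j \<Longrightarrow> nmul (j - i) x = nmul j x - nmul i (x::'a::ab_group_add)"
  using nmul_add[of "j - i" i x] by (simp add: algebra_simps)

lemma nmul_additive:
  assumes "f 0 = 0" and "\<And>x y. f (x + y) = f x + f y"
  shows "f (nmul n x) = nmul n (f x)"
  by (induction n) (simp_all add: assms nmul_simps)

section \<open>Finitely generated submonoids\<close>

lemma add_submonoid_hull: "add_submonoid (add_submonoid hull G)"
  by (rule hull_in) (auto simp: add_submonoid_def)

lemma fg_imp_add_submonoid: "fg_monoid M \<Longrightarrow> add_submonoid M"
  unfolding fg_monoid_def using add_submonoid_hull by blast

lemma add_submonoidD: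
  assumes "add_submonoid M"
  shows "0 \<in> M" and "x \<in> M \<Longrightarrow> y \<in> M \<Longrightarrow> x + y \<in> M"
  using assms by (auto simp: add_submonoid_def)

lemma add_submonoidI:
  "0 \<in> M \<Longrightarrow> (\<And>x y. x \<in> M \<Longrightarrow> y \<in> M \<Longrightarrow> x + y \<in> M) \<Longrightarrow> add_submonoid M"
  by (auto simp: add_submonoid_def)

lemma add_submonoid_nmul: "add_submonoid M \<Longrightarrow> x \<in> M \<Longrightarrow> nmul n x \<in> M"
  by (induction n) (auto simp: nmul_simps add_submonoid_def)

lemma hull_insertE:
  assumes "x \<in> add_submonoid hull (insert g G)"
  obtains k s where "s \<in> add_submonoid hull G" "x = nmul k g + s"
proof -
  let ?T = "{nmul k g + s | k s. s \<in> add_submonoid hull G}"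
  have "add_submonoid ?T"
  proof (rule add_submonoidI)
    show "0 \<in> ?T"
      using add_submonoidD(1)[OF add_submonoid_hull[of G]]
      by (intro CollectI exI[of _ 0]) simp
  next
    fix x y assume "x \<in> ?T" "y \<in> ?T"
    then obtain k s k' s' where "x = nmul k g + s" "y = nmul k' g + s'"
      "s \<in> add_submonoid hull G" "s' \<in> add_submonoid hull G"
      by blast
    moreover from this have "x + y = nmul (k + k') g + (s + s')" by (simp add: nmul_add ac_simps)
    ultimately show "x + y \<in> ?T"
      using add_submonoidD(2)[OF add_submonoid_hull[of G]] by blast
  qed
  moreover have "insert g G \<subseteq> ?T"
  proof
    fix x assume "x \<in> insert g G"
    then have "x = nmul 1 g + 0 \<or> x = nmul 0 g + x \<and> x \<in> G" by auto
    then show "x \<in> ?T"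
      using add_submonoidD(1)[OF add_submonoid_hull[of G]] hull_inc[of x G] by blast
  qed
  ultimately have "x \<in> ?T" using assms hull_minimal[of "insert g G" ?T] by blast
  then show thesis using that by blast
qed

lemma hull_empty: "add_submonoid hull {} = {0}"
  by (rule hull_unique) (auto simp: add_submonoid_def)

text \<open>Generators that are summands of \<open>x\<close> remain summands of
  \<open>x + y\<close>, so the elements with this property form a submonoid; it contains
  \<open>G\<close>.\<close>

lemma mem_hull_summands:
  assumes "b \<in> add_submonoid hull G"
  shows "b \<in> add_submonoid hull {g \<in> G. \<exists>c \<in> add_submonoid hull G. b = g + c}"
    (is "_ \<in> _ hull (?I b)")
proof -
  let ?S = "{b. b \<in> add_submonoid hull G \<and> b \<in> add_submonoid hull (?I b)}"
  have "add_submonoid ?S"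
  proof (rule add_submonoidI)
    show "0 \<in> ?S" by (simp add: add_submonoidD[OF add_submonoid_hull])
  next
    fix x y assume xy: "x \<in> ?S" "y \<in> ?S"
    note hull_add = add_submonoidD(2)[OF add_submonoid_hull[of G]]
    have I: "?I x \<subseteq> ?I (x + y)" if "y \<in> add_submonoid hull G" for x y
      using hull_add[OF _ that] by (auto simp: add.assoc)
    have sub: "?I x \<subseteq> ?I (x + y)" "?I y \<subseteq> ?I (x + y)"
      using I[of y x] I[of x y] xy by (simp_all add: add.commute)
    then show "x + y \<in> ?S"
      using xy add_submonoidD(2)[OF add_submonoid_hull[of G]]
        add_submonoidD(2)[OF add_submonoid_hull[of "?I (x + y)"]]
        hull_mono[OF sub(1), of add_submonoid] hull_mono[OF sub(2), of add_submonoid]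
      by blast
  qed
  moreover have "G \<subseteq> ?S"
  proof
    fix x assume x: "x \<in> G"
    then have "x \<in> ?I x"
      using add_submonoidD(1)[OF add_submonoid_hull[of G]] by force
    then show "x \<in> ?S" using x by (simp add: hull_inc)
  qed
  ultimately have "add_submonoid hull G \<subseteq> ?S" by (simp add: hull_minimal)
  then show "b \<in> add_submonoid hull (?I b)" using assms by blast
qed

section \<open>Dickson's lemma for finitely generated monoids\<close>

text \<open>A monotone subsequence exists; if it decreases, it is constant from a least value
  on.\<close>

lemma nat_seq_incseq_subseq:
  fixes k :: "nat \<Rightarrow> nat"
  obtains r :: "nat \<Rightarrow> nat" where "strict_mono r" "\<And>i j. i \<le> j \<Longrightarrow> k (r i) \<le> k (r j)"
proof -
  obtain r :: "nat \<Rightarrow> nat" where r: "strict_mono r" "monoseq (k \<circ> r)"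
    using seq_monosub[of k] by (auto simp: o_def)
  show thesis
  proof (cases "incseq (k \<circ> r)")
    case True
    then show ?thesis using that[OF r(1)] by (simp add: incseq_def)
  next
    case False
    then have dec: "decseq (k \<circ> r)" using r by (auto simp: monoseq_iff)
    obtain n where n: "\<And>m. k (r n) \<le> k (r m)"
      using ex_has_least_nat[of "\<lambda>_. True" _ "\<lambda>n. k (r n)"] by blast
    have "k (r (i + n)) = k (r n)" for i
      using n[of "i + n"] dec by (auto simp: decseq_def intro: antisym)
    moreover have "strict_mono (\<lambda>i. r (i + n))"
      using r by (auto simp: strict_mono_def)
    ultimately show ?thesis using that[of "\<lambda>i. r (i + n)"] by auto
  qed
qed

text \<open>Induction on the generators: the coefficients of \<open>g\<close> are first made
  nondecreasing along a subsequence, then the induction hypothesis treats the remaining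
  summands.\<close>

lemma fg_monoid_dickson:
  fixes f :: "nat \<Rightarrow> 'a::comm_monoid_add"
  assumes "fg_monoid M" and "\<And>n. f n \<in> M"
  obtains r :: "nat \<Rightarrow> nat" where "strict_mono r" "\<And>i j. i \<le> j \<Longrightarrow> mdvd M (f (r i)) (f (r j))"
proof -
  obtain G where "finite G" and M: "M = add_submonoid hull G"
    using assms(1) by (auto simp: fg_monoid_def)
  have "\<exists>r :: nat \<Rightarrow> nat. strict_mono r \<and> (\<forall>i j. i \<le> j \<longrightarrow> mdvd (add_submonoid hull G) (f (r i)) (f (r j)))"
    if "\<And>n. f n \<in> add_submonoid hull G" for f :: "nat \<Rightarrow> 'a"
    using \<open>finite G\<close> that
  proof (induction G arbitrary: f)
    case empty
    then have "f n = 0" for n by (simp add: hull_empty)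
    then show ?case
      by (intro exI[of _ "id :: nat \<Rightarrow> nat"]) (simp add: hull_empty strict_mono_def mdvd_def)
  next
    case (insert g G)
    have "\<exists>k s. s \<in> add_submonoid hull G \<and> f n = nmul k g + s" for n
      using hull_insertE[OF insert.prems] by blast
    then obtain k s where s: "\<And>n. s n \<in> add_submonoid hull G" and f: "\<And>n. f n = nmul (k n) g + s n"
      by metis
    obtain r1 :: "nat \<Rightarrow> nat" where r1: "strict_mono r1" "\<And>i j. i \<le> j \<Longrightarrow> k (r1 i) \<le> k (r1 j)"
      using nat_seq_incseq_subseq[of k] by blast
    obtain r2 :: "nat \<Rightarrow> nat" where r2: "strict_mono r2"
      "\<And>i j. i \<le> j \<Longrightarrow> mdvd (add_submonoid hull G) (s (r1 (r2 i))) (s (r1 (r2 j)))"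
      using insert.IH[of "s \<circ> r1"] s by auto
    have "mdvd (add_submonoid hull insert g G) (f (r1 (r2 i))) (f (r1 (r2 j)))" if "i \<le> j" for i j
    proof -
      obtain t where t: "t \<in> add_submonoid hull G" "s (r1 (r2 j)) = s (r1 (r2 i)) + t"
        using r2(2)[OF \<open>i \<le> j\<close>] by (auto simp: mdvd_def)
      have "r2 i \<le> r2 j" using r2(1) that by (simp add: strict_mono_less_eq)
      then obtain l where l: "k (r1 (r2 j)) = k (r1 (r2 i)) + l"
        using r1(2) le_Suc_ex by blast
      have "nmul l g + t \<in> add_submonoid hull insert g G"
        using t(1) hull_mono[of G "insert g G" add_submonoid]
        by (intro add_submonoidD add_submonoid_nmul add_submonoid_hull) (auto intro: hull_inc)
      then show ?thesis
        unfolding mdvd_def f l t(2) nmul_add by (auto intro!: bexI[of _ "nmul l g + t"] simp: ac_simps)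
    qed
    moreover have "strict_mono (r1 \<circ> r2)" using r1(1) r2(1) by (simp add: strict_mono_o)
    ultimately show ?case by (intro exI[of _ "r1 \<circ> r2"]) (simp add: o_def)
  qed
  then show thesis using that assms(2) M by blast
qed

lemma fg_monoid_image:
  assumes "fg_monoid M" and "f 0 = 0" and "\<And>x y. f (x + y) = f x + f y"
  shows "fg_monoid (f ` M)"
proof -
  obtain G where G: "finite G" "M = add_submonoid hull G"
    using assms(1) by (auto simp: fg_monoid_def)
  have "f ` M = add_submonoid hull (f ` G)"
  proof (rule hull_unique[symmetric])
    show "f ` G \<subseteq> f ` M" using G by (auto intro: hull_inc)
    show "add_submonoid (f ` M)"
    proof (rule add_submonoidI)
      show "0 \<in> f ` M"
        using add_submonoidD(1)[OF fg_imp_add_submonoid[OF assms(1)]] assms(2) by force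
      show "x + y \<in> f ` M" if "x \<in> f ` M" "y \<in> f ` M" for x y
        using that add_submonoidD(2)[OF fg_imp_add_submonoid[OF assms(1)]] assms(3)[symmetric] by auto
    qed
  next
    fix T assume T: "f ` G \<subseteq> T" "add_submonoid T"
    have "add_submonoid (f -` T)" using T(2) assms(2,3) by (auto simp: add_submonoid_def)
    then have "M \<subseteq> f -` T" unfolding G(2) using T(1) by (intro hull_minimal) auto
    then show "f ` M \<subseteq> T" by blast
  qed
  then show ?thesis using G(1) unfolding fg_monoid_def by blast
qed

section \<open>Subgroups of finitely generated groups\<close>

definition add_subgroup :: "'a::ab_group_add set \<Rightarrow> bool" where
  "add_subgroup H \<longleftrightarrow> 0 \<in> H \<and> (\<forall>x\<in>H. \<forall>y\<in>H. x - y \<in> H)"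

lemma add_subgroupD:
  assumes "add_subgroup H"
  shows "0 \<in> H" and "x \<in> H \<Longrightarrow> y \<in> H \<Longrightarrow> x - y \<in> H" and "x \<in> H \<Longrightarrow> - x \<in> H"
    and "x \<in> H \<Longrightarrow> y \<in> H \<Longrightarrow> x + y \<in> H"
proof -
  show d: "x - y \<in> H" if "x \<in> H" "y \<in> H" for x y
    using assms that by (auto simp: add_subgroup_def)
  show m: "- x \<in> H" if "x \<in> H" for x using d[of 0 x] that assms by (auto simp: add_subgroup_def)
  show "x + y \<in> H" if "x \<in> H" "y \<in> H" for x y using d[of x "- y"] m[of y] that by simp
  show "0 \<in> H" using assms by (auto simp: add_subgroup_def)
qed

lemma add_subgroup_nmul: "add_subgroup H \<Longrightarrow> x \<in> H \<Longrightarrow> nmul n x \<in> H"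
  by (induction n) (auto simp: nmul_simps add_subgroupD)

definition diff_group :: "'a::ab_group_add set \<Rightarrow> 'a set" where
  "diff_group M = {a - b | a b. a \<in> M \<and> b \<in> M}"

lemma add_subgroup_diff_group:
  assumes "add_submonoid M"
  shows "add_subgroup (diff_group M)"
  unfolding add_subgroup_def
proof (intro conjI ballI)
  show "0 \<in> diff_group M" using add_submonoidD(1)[OF assms] unfolding diff_group_def by force
next
  fix x y assume "x \<in> diff_group M" "y \<in> diff_group M"
  then obtain a b c d where "x = a - b" "y = c - d" "a \<in> M" "b \<in> M" "c \<in> M" "d \<in> M"
    unfolding diff_group_def by blast
  moreover from this have "x - y = (a + d) - (b + c)" by simp
  ultimately show "x - y \<in> diff_group M"
    unfolding diff_group_def using add_submonoidD(2)[OF assms] by blast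
qed

text \<open>In a finitely generated group every subgroup \<open>H\<close> is finitely generated; hence if \<open>H / K\<close> is
  torsion, then it has finite exponent.\<close>

lemma torsion_exponent_bounded:
  fixes H K :: "'a::ab_group_add set"
  assumes "finite G" and "add_subgroup H" and "H \<subseteq> diff_group (add_submonoid hull G)"
    and "add_subgroup K" and "\<And>h. h \<in> H \<Longrightarrow> \<exists>k\<ge>1. nmul k h \<in> K"
  shows "\<exists>M\<ge>1. \<forall>h\<in>H. nmul M h \<in> K"
  using assms(1,2,3,5)
proof (induction G arbitrary: H)
  case empty
  then have "H \<subseteq> {0}" by (auto simp: hull_empty diff_group_def)
  then show ?case using add_subgroupD(1)[OF assms(4)] by (intro exI[of _ 1]) auto
next
  case (insert g G)
  let ?L = "diff_group (add_submonoid hull G)"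
  have L: "add_subgroup ?L" by (intro add_subgroup_diff_group add_submonoid_hull)
  have "add_subgroup (H \<inter> ?L)"
    using L insert.prems(1) by (auto simp: add_subgroup_def)
  then obtain M where M: "M \<ge> 1" "\<And>h. h \<in> H \<inter> ?L \<Longrightarrow> nmul M h \<in> K"
    using insert.IH[of "H \<inter> ?L"] insert.prems(3) by auto
  \<comment> \<open>Since \<open>nmul\<close> takes natural factors only, the two cases are the two
    signs of a coefficient of \<open>g\<close> in \<open>h\<close>.\<close>
  have repr: "\<exists>a. h + nmul a g \<in> ?L \<or> h - nmul a g \<in> ?L" if h: "h \<in> H" for h
  proof -
    obtain u v where uv: "h = u - v" "u \<in> add_submonoid hull insert g G" "v \<in> add_submonoid hull insert g G"
      using subsetD[OF insert.prems(2) h] unfolding diff_group_def by blast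
    obtain k s where k: "u = nmul k g + s" "s \<in> add_submonoid hull G" using uv by (auto elim: hull_insertE)
    obtain l t where l: "v = nmul l g + t" "t \<in> add_submonoid hull G" using uv by (auto elim: hull_insertE)
    have st: "s - t \<in> ?L" using k l by (auto simp: diff_group_def)
    show ?thesis
    proof (cases "k \<le> l")
      case True
      then have "h + nmul (l - k) g = s - t" by (simp add: uv k l nmul_diff_left)
      then show ?thesis using st by metis
    next
      case False
      then have "h - nmul (k - l) g = s - t" by (simp add: uv k l nmul_diff_left)
      then show ?thesis using st by metis
    qed
  qed
  define R where "R a h \<longleftrightarrow> h \<in> H \<and> h - nmul a g \<in> ?L" for a h
  show ?case
  proof (cases "\<exists>a h. a \<ge> 1 \<and> R a h")
    case False
    have "h \<in> ?L" if h: "h \<in> H" for h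
    proof -
      obtain a where a: "h + nmul a g \<in> ?L \<or> h - nmul a g \<in> ?L" using repr[OF h] by blast
      then have "R a h \<or> R a (- h)"
        using h add_subgroupD(3)[OF insert.prems(1) h] add_subgroupD(3)[OF L, of "h + nmul a g"]
        by (auto simp: R_def)
      then have "a = 0" using False by (cases a) auto
      then show ?thesis using a by simp
    qed
    then show ?thesis using M by blast
  next
    case True
    \<comment> \<open>The integer coefficients of \<open>g\<close> modulo \<open>?L\<close> in
      elements of \<open>H\<close> form a subgroup of the integers; \<open>d\<close> is its positive
      generator.\<close>
    define d where "d = (LEAST a. a \<ge> 1 \<and> (\<exists>h. R a h))"
    have d: "d \<ge> 1" "\<exists>h. R d h" and d_le: "\<And>a h. a \<ge> 1 \<Longrightarrow> R a h \<Longrightarrow> d \<le> a"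
      using LeastI_ex[of "\<lambda>a. a \<ge> 1 \<and> (\<exists>h. R a h)"] True
        Least_le[of "\<lambda>a. a \<ge> 1 \<and> (\<exists>h. R a h)"] unfolding d_def by blast+
    obtain h0 where h0: "R d h0" using d by blast
    obtain k where k: "k \<ge> 1" "nmul k h0 \<in> K"
      using insert.prems(3) h0 by (auto simp: R_def)
    have pos: "nmul (k * M) h \<in> K" if h: "R a h" for a h
    proof -
      \<comment> \<open>Division with remainder: \<open>?h\<close> has coefficient
        \<open>a mod d\<close>, which vanishes by minimality of \<open>d\<close>.\<close>
      let ?h = "h - nmul (a div d) h0"
      have 1: "?h \<in> H"
        using h h0 insert.prems(1) by (simp add: R_def add_subgroupD add_subgroup_nmul)
      have "nmul a g = nmul (a div d) (nmul d g) + nmul (a mod d) g"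
        by (simp only: nmul_mult[symmetric] nmul_add[symmetric] div_mult_mod_eq)
      then have "?h - nmul (a mod d) g = (h - nmul a g) - nmul (a div d) (h0 - nmul d g)"
        by (simp add: nmul_distribs algebra_simps)
      also have "\<dots> \<in> ?L"
        using h h0 L by (simp add: R_def add_subgroupD add_subgroup_nmul)
      finally have 2: "R (a mod d) ?h" using 1 by (simp add: R_def)
      have "a mod d = 0"
        using d_le[OF _ 2] mod_less_divisor[of d a] d(1) by linarith
      then have "?h \<in> H \<inter> ?L" using 1 2 by (simp add: R_def)
      then have "nmul k (nmul M ?h) + nmul (M * (a div d)) (nmul k h0) \<in> K"
        using M k assms(4) by (simp add: add_subgroupD add_subgroup_nmul)
      moreover have "nmul k (nmul M ?h) + nmul (M * (a div d)) (nmul k h0) = nmul (k * M) h"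
        by (simp add: nmul_distribs nmul_mult[symmetric] ac_simps)
      ultimately show ?thesis by simp
    qed
    have "nmul (k * M) h \<in> K" if h: "h \<in> H" for h
    proof -
      obtain a where "h + nmul a g \<in> ?L \<or> h - nmul a g \<in> ?L" using repr[OF h] by blast
      then have "R a h \<or> R a (- h)"
        using h add_subgroupD(3)[OF insert.prems(1) h] add_subgroupD(3)[OF L, of "h + nmul a g"]
        by (auto simp: R_def)
      then show ?thesis
        using pos[of a h] pos[of a "- h"] add_subgroupD(3)[OF assms(4), of "nmul (k * M) (- h)"]
        by (auto simp: nmul_uminus)
    qed
    then show ?thesis using M(1) k(1) by (intro exI[of _ "k * M"]) (simp add: Suc_le_eq)
  qed
qed

section \<open>Rational closures and maximal parts\<close>

text \<open>For a submonoid of a rational vector space this is the cone it spans over the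
  nonnegative rationals, written with multiples instead of scalars.\<close>

definition rat_closure :: "'a::comm_monoid_add set \<Rightarrow> 'a set" where
  "rat_closure S = {v. \<exists>n\<ge>1. nmul n v \<in> S}"

lemma rat_closureI: "n \<ge> 1 \<Longrightarrow> nmul n v \<in> S \<Longrightarrow> v \<in> rat_closure S"
  by (auto simp: rat_closure_def)

lemma rat_closure_superset: "S \<subseteq> rat_closure S"
  by (auto intro!: rat_closureI[of 1])

lemma rat_closure_mono: "S \<subseteq> T \<Longrightarrow> rat_closure S \<subseteq> rat_closure T"
  by (auto simp: rat_closure_def)

lemma add_submonoid_rat_closure:
  assumes "add_submonoid S"
  shows "add_submonoid (rat_closure S)"
proof (rule add_submonoidI)
  show "0 \<in> rat_closure S"
    using add_submonoidD(1)[OF assms] rat_closure_superset by blast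
next
  fix v w assume "v \<in> rat_closure S" "w \<in> rat_closure S"
  then obtain n m where nm: "n \<ge> 1" "nmul n v \<in> S" "m \<ge> 1" "nmul m w \<in> S"
    by (auto simp: rat_closure_def)
  have "nmul (m * n) (v + w) = nmul m (nmul n v) + nmul n (nmul m w)"
    by (simp add: nmul_simps(4) nmul_mult nmul_left_commute)
  then show "v + w \<in> rat_closure S"
    using nm assms by (intro rat_closureI[of "m * n"]) (auto simp: add_submonoidD add_submonoid_nmul)
qed

lemma rat_closure_nmul_iff:
  assumes "add_submonoid S" and "n \<ge> 1"
  shows "nmul n v \<in> rat_closure S \<longleftrightarrow> v \<in> rat_closure S"
proof
  assume "nmul n v \<in> rat_closure S"
  then obtain m where "m \<ge> 1" "nmul (m * n) v \<in> S"
    by (auto simp: rat_closure_def nmul_mult)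
  then show "v \<in> rat_closure S" using assms(2) by (intro rat_closureI[of "m * n"]) (auto simp: Suc_le_eq)
qed (intro add_submonoid_nmul add_submonoid_rat_closure assms(1))

text \<open>\<open>A\<close> and \<open>B\<close> play the roles of \<open>P\<close> and \<open>Q\<close> inside the rational
  vector space \<open>Q\<^sup>g\<^sup>p \<otimes> \<rat>\<close>.\<close>

locale saturated_pair =
  fixes A B :: "'v::ab_group_add set"
  assumes torsion_free: "n \<ge> 1 \<Longrightarrow> nmul n v = 0 \<Longrightarrow> v = (0::'v)"
    and divisible: "n \<ge> 1 \<Longrightarrow> \<exists>w. nmul n w = (v::'v)"
    and A_subset_B: "A \<subseteq> B"
    and fg_A: "fg_monoid A"
    and fg_B: "fg_monoid B"
    and saturated_A: "a \<in> A \<Longrightarrow> b \<in> A \<Longrightarrow> a - b \<in> rat_closure A \<Longrightarrow> a - b \<in> A"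
    and saturated_B: "a \<in> B \<Longrightarrow> b \<in> B \<Longrightarrow> a - b \<in> rat_closure B \<Longrightarrow> a - b \<in> B"
    and opposite: "v \<in> rat_closure B \<Longrightarrow> - v \<in> rat_closure A \<Longrightarrow> v = 0"
begin

abbreviation "CA \<equiv> rat_closure A"
abbreviation "CB \<equiv> rat_closure B"

lemma submonoid_A: "add_submonoid A" and submonoid_B: "add_submonoid B"
  by (rule fg_imp_add_submonoid fg_A fg_B)+

lemma submonoid_CA: "add_submonoid CA" and submonoid_CB: "add_submonoid CB"
  by (intro add_submonoid_rat_closure submonoid_A submonoid_B)+

lemmas closed =
  add_submonoidD[OF submonoid_A] add_submonoidD[OF submonoid_B]
  add_submonoidD[OF submonoid_CA] add_submonoidD[OF submonoid_CB]
  add_submonoid_nmul[OF submonoid_A] add_submonoid_nmul[OF submonoid_B]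
  add_submonoid_nmul[OF submonoid_CA] add_submonoid_nmul[OF submonoid_CB]

lemma A_CA: "a \<in> A \<Longrightarrow> a \<in> CA" and B_CB: "a \<in> B \<Longrightarrow> a \<in> CB" and CA_CB: "a \<in> CA \<Longrightarrow> a \<in> CB"
  using rat_closure_superset rat_closure_mono[OF A_subset_B] by blast+

lemma CA_nmul_iff: "n \<ge> 1 \<Longrightarrow> nmul n v \<in> CA \<longleftrightarrow> v \<in> CA"
  and CB_nmul_iff: "n \<ge> 1 \<Longrightarrow> nmul n v \<in> CB \<longleftrightarrow> v \<in> CB"
  by (simp_all add: rat_closure_nmul_iff submonoid_A submonoid_B)

lemma nmul_inject: "n \<ge> 1 \<Longrightarrow> nmul n v = nmul n w \<longleftrightarrow> v = (w::'v)"
  using torsion_free[of n "v - w"] by (auto simp: nmul_diff)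

lemma nmul_eq_0: "n \<ge> 1 \<Longrightarrow> nmul n v = 0 \<longleftrightarrow> v = (0::'v)"
  using torsion_free by auto

text \<open>The cone \<open>CA\<close> is sharp by \<open>opposite\<close>, because it is contained
  in \<open>CB\<close>; so differences in \<open>CA\<close> define a partial order.\<close>

lemma CA_antisym: "a - b \<in> CA \<Longrightarrow> b - a \<in> CA \<Longrightarrow> a = b"
  using opposite[of "a - b"] CA_CB by simp

text \<open>Only the summand \<open>z\<close> in \<open>CA\<close> is recorded; the other summand of
  the minimal decomposition is \<open>y - z\<close>.\<close>

definition maximal_part :: "'v \<Rightarrow> 'v \<Rightarrow> bool" where
  "maximal_part y z \<longleftrightarrow> z \<in> CA \<and> y - z \<in> CB \<and> (\<forall>x \<in> CA - {0}. y - z - x \<notin> CB)"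

definition unique_maximal_parts :: bool where
  "unique_maximal_parts \<longleftrightarrow> (\<forall>y \<in> CB. \<exists>!z. maximal_part y z)"

text \<open>Divisibility is expressed by differences in the ambient group, and the homomorphism is
  the inclusion.\<close>

definition pseudo_saturated_pair :: bool where
  "pseudo_saturated_pair \<longleftrightarrow>
     (\<exists>M\<ge>1. \<forall>n\<ge>1. \<forall>x\<in>A. \<forall>y\<in>B. nmul n y - x \<in> B \<longrightarrow>
        (\<exists>x'\<in>A. nmul n x' - nmul M x \<in> A \<and> nmul M y - x' \<in> B))"

text \<open>Multiplication by \<open>n\<close> is an automorphism of the ambient group that
  preserves and reflects both cones, so denominators of \<open>y\<close> may be cleared.\<close>

lemma maximal_part_nmul_iff:
  assumes "n \<ge> 1"
  shows "maximal_part (nmul n y) (nmul n z) \<longleftrightarrow> maximal_part y z"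
proof -
  have "(\<forall>x \<in> CA - {0}. nmul n (y - z) - x \<notin> CB) \<longleftrightarrow> (\<forall>x \<in> CA - {0}. y - z - x \<notin> CB)"
    (is "?l \<longleftrightarrow> ?r")
  proof
    assume ?l
    show ?r
    proof
      fix x assume x: "x \<in> CA - {0}"
      then have "nmul n x \<in> CA - {0}" using assms by (simp add: CA_nmul_iff nmul_eq_0)
      then have "nmul n (y - z) - nmul n x \<notin> CB" using \<open>?l\<close> by blast
      then show "y - z - x \<notin> CB" using CB_nmul_iff[OF assms] by (simp add: nmul_diff[symmetric])
    qed
  next
    assume ?r
    show ?l
    proof
      fix x assume x: "x \<in> CA - {0}"
      obtain w where w: "nmul n w = x" using divisible[OF assms] by blast
      then have "w \<in> CA - {0}" using x CA_nmul_iff[OF assms, of w] by auto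
      then have "y - z - w \<notin> CB" using \<open>?r\<close> by blast
      then show "nmul n (y - z) - x \<notin> CB"
        using CB_nmul_iff[OF assms, of "y - z - w"] w by (simp add: nmul_diff)
    qed
  qed
  then show ?thesis
    unfolding maximal_part_def nmul_diff[symmetric] CA_nmul_iff[OF assms] CB_nmul_iff[OF assms] by simp
qed

lemma ex1_maximal_part_nmul:
  assumes "n \<ge> 1" and "\<exists>!z. maximal_part (nmul n y) z"
  shows "\<exists>!z. maximal_part y z"
proof -
  obtain z where z: "maximal_part (nmul n y) z" using assms(2) by blast
  obtain w where "nmul n w = z" using divisible[OF assms(1)] by blast
  then have "maximal_part y w" using z maximal_part_nmul_iff[OF assms(1)] by blast
  moreover have "v = w" if "maximal_part y v" for v
  proof -
    have "nmul n v = nmul n w"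
      using assms(2) that \<open>maximal_part y w\<close> maximal_part_nmul_iff[OF assms(1)] by blast
    then show ?thesis using nmul_inject[OF assms(1)] by blast
  qed
  ultimately show ?thesis by blast
qed

lemma maximal_part_eqI:
  assumes "maximal_part y z" and "x \<in> CA" and "y - x \<in> CB" and "x - z \<in> CA"
  shows "x = z"
proof (rule ccontr)
  assume "x \<noteq> z"
  then have "x - z \<in> CA - {0}" using assms(4) by simp
  then have "y - z - (x - z) \<notin> CB" using assms(1) unfolding maximal_part_def by blast
  then show False using assms(3) by simp
qed

lemma common_multiple:
  assumes "x \<in> rat_closure S" "y \<in> rat_closure S" "add_submonoid S"
  obtains k where "k \<ge> 1" "nmul k x \<in> S" "nmul k y \<in> S"
proof -
  obtain m n where "m \<ge> 1" "nmul m x \<in> S" "n \<ge> 1" "nmul n y \<in> S"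
    using assms(1,2) by (auto simp: rat_closure_def)
  then show thesis
    using that[of "m * n"] add_submonoid_nmul[OF assms(3)]
    by (metis nmul_mult mult.commute mult_le_mono nat_mult_1)
qed

section \<open>Finiteness and closedness from Dickson's lemma\<close>

text \<open>Dickson's lemma, applied to the elements \<open>x\<close> in \<open>A\<close> and to
  \<open>y - x\<close> in \<open>B\<close>, would give two distinct divisors whose difference lies
  in \<open>A\<close> and its negative in \<open>B\<close>; \<open>opposite\<close> forbids
  this.\<close>

lemma finite_divisors: "finite {x \<in> A. y - x \<in> B}"
proof (rule ccontr)
  assume "infinite {x \<in> A. y - x \<in> B}"
  then obtain f :: "nat \<Rightarrow> 'v" where inj: "inj f" and f: "\<And>n. f n \<in> A" "\<And>n. y - f n \<in> B"
    using infinite_countable_subset[of "{x \<in> A. y - x \<in> B}"] by blast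
  obtain r :: "nat \<Rightarrow> nat" where r: "strict_mono r" "\<And>i j. i \<le> j \<Longrightarrow> mdvd A (f (r i)) (f (r j))"
    using fg_monoid_dickson[OF fg_A, of f] f by blast
  obtain s :: "nat \<Rightarrow> nat" where s: "strict_mono s"
    "\<And>i j. i \<le> j \<Longrightarrow> mdvd B (y - f (r (s i))) (y - f (r (s j)))"
    using fg_monoid_dickson[OF fg_B, of "\<lambda>n. y - f (r n)"] f by blast
  have lt: "r (s 0) < r (s 1)" using r(1) s(1) by (simp add: strict_mono_def)
  have "s 0 \<le> s 1" using s(1) by (simp add: strict_mono_less_eq)
  then obtain a where "a \<in> A" "f (r (s 1)) = f (r (s 0)) + a"
    using r(2) by (auto simp: mdvd_def)
  moreover obtain b where "b \<in> B" "y - f (r (s 1)) = y - f (r (s 0)) + b"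
    using s(2)[of 0 1] by (auto simp: mdvd_def)
  ultimately have ab: "b \<in> B" "a \<in> A" "a + b = 0" "f (r (s 1)) = f (r (s 0)) + a"
    by (auto simp: algebra_simps)
  then have "a = - b" by (simp add: eq_neg_iff_add_eq_0)
  then have "b \<in> CB" "- b \<in> CA" "f (r (s 1)) = f (r (s 0)) - b"
    using ab B_CB A_CA[of a] by auto
  then have "f (r (s 1)) = f (r (s 0))" using opposite[of b] by simp
  then show False using lt inj by (auto dest: injD)
qed

text \<open>This replaces topological closedness of the cone: dividing by \<open>n\<close>, the
  point \<open>x - z1\<close> is a limit of points of \<open>CA\<close>. By Dickson's lemma the
  difference of two terms, a positive multiple of \<open>x - z1\<close>, has a multiple in
  \<open>A\<close>.\<close>

lemma CA_limit:
  assumes "x \<in> CA" "z1 \<in> CA" "z2 \<in> CA"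
    and "infinite {n. nmul n (x - z1) + (x - z2) \<in> CA}"
  shows "x - z1 \<in> CA"
proof -
  obtain k where k: "k \<ge> 1" "nmul k x \<in> A" "nmul k z1 \<in> A"
    using common_multiple assms submonoid_A by metis
  obtain l where l: "l \<ge> 1" "nmul l z2 \<in> A"
    using assms(3) by (auto simp: rat_closure_def)
  define m where "m = k * l"
  have m: "m \<ge> 1" "nmul m x \<in> A" "nmul m z1 \<in> A" "nmul m z2 \<in> A"
    using k l closed(9)[of "nmul k x" l] closed(9)[of "nmul k z1" l] closed(9)[of "nmul l z2" k]
    by (auto simp: m_def nmul_mult nmul_left_commute[of k l] Suc_le_eq)
  let ?N = "{n. nmul n (x - z1) + (x - z2) \<in> CA}"
  define f where "f n = nmul (enumerate ?N n) (x - z1) + (x - z2)" for n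
  have "nmul m (f n) \<in> A" for n
  proof -
    let ?e = "enumerate ?N n"
    have "f n \<in> CA" using enumerate_in_set[OF assms(4)] by (simp add: f_def)
    \<comment> \<open>Clearing denominators by \<open>m\<close> makes this a difference of elements
      of \<open>A\<close>; as it lies in \<open>CA\<close>, saturation puts it in
      \<open>A\<close>.\<close>
    moreover have eq: "nmul m (f n) = nmul ?e (nmul m x) + nmul m x - (nmul ?e (nmul m z1) + nmul m z2)"
      by (simp add: f_def nmul_distribs nmul_left_commute[of m] algebra_simps)
    ultimately show ?thesis
      using closed(11)[of "f n" m] closed(2)[OF closed(9)[OF m(2)] m(2)] closed(2)[OF closed(9)[OF m(3)] m(4)]
      by (simp add: saturated_A)
  qed
  then obtain r :: "nat \<Rightarrow> nat" where r: "strict_mono r" "\<And>i j. i \<le> j \<Longrightarrow> mdvd A (nmul m (f (r i))) (nmul m (f (r j)))"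
    using fg_monoid_dickson[OF fg_A, of "\<lambda>n. nmul m (f n)"] by blast
  define i j where "i = enumerate ?N (r 0)" and "j = enumerate ?N (r 1)"
  have "i < j"
    unfolding i_def j_def using r(1) assms(4) by (intro enumerate_mono) (auto simp: strict_mono_def)
  have "nmul m (f (r 1)) - nmul m (f (r 0)) \<in> A"
    using r(2)[of 0 1] by (auto simp: mdvd_def)
  also have "nmul m (f (r 1)) - nmul m (f (r 0)) = nmul (m * (j - i)) (x - z1)"
    using \<open>i < j\<close> unfolding f_def i_def[symmetric] j_def[symmetric]
    by (simp add: nmul_mult nmul_diff_left nmul_diff[symmetric])
  finally show ?thesis
    using \<open>i < j\<close> m(1) by (intro rat_closureI[of "m * (j - i)"]) auto
qed

section \<open>Pseudo-saturation implies unique decompositions\<close>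

text \<open>For two maximal parts \<open>z1\<close>, \<open>z2\<close> the points \<open>(n z1 + z2) / (n + 1)\<close> are all dominated by
  members of the finite set \<open>F\<close>; one member works for infinitely many \<open>n\<close>, so in the limit it
  dominates \<open>z1\<close>, and hence equals it.\<close>

lemma ex1_maximal_part_if_cofinal:
  assumes "y \<in> CB" and "finite F" and "F \<subseteq> CA" and "\<And>x. x \<in> F \<Longrightarrow> y - x \<in> CB"
    and cofinal: "\<And>z. z \<in> CA \<Longrightarrow> y - z \<in> CB \<Longrightarrow> \<exists>x\<in>F. x - z \<in> CA"
  shows "\<exists>!z. maximal_part y z"
proof (rule ex_ex1I)
  have "F \<noteq> {}" using cofinal[of 0] closed(5) assms(1) by auto
  \<comment> \<open>\<open>F\<close> is finite and nonempty, so it has a maximal element for the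
    order given by \<open>CA\<close>.\<close>
  obtain m where m: "m \<in> F" "\<And>x. x \<in> F \<Longrightarrow> x - m \<in> CA \<Longrightarrow> x = m"
  proof -
    have "\<exists>m\<in>F. \<forall>x\<in>F. x \<noteq> m \<longrightarrow> \<not> (x - m \<in> CA \<and> x \<noteq> m)"
    proof (rule Finite_Set.bex_max_element[OF assms(2) _ _ \<open>F \<noteq> {}\<close>])
      show "asymp_on F (\<lambda>m x. x - m \<in> CA \<and> x \<noteq> m)"
        using CA_antisym by (auto intro!: asymp_onI)
      show "transp_on F (\<lambda>m x. x - m \<in> CA \<and> x \<noteq> m)"
      proof (rule transp_onI)
        fix a b c assume "b - a \<in> CA \<and> b \<noteq> a" "c - b \<in> CA \<and> c \<noteq> b"
        moreover from this have "c - a \<in> CA" using closed(6)[of "c - b" "b - a"] by simp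
        ultimately show "c - a \<in> CA \<and> c \<noteq> a" using CA_antisym by auto
      qed
    qed
    then show thesis using that by blast
  qed
  \<comment> \<open>By cofinality \<open>m + x\<close> would lie below some \<open>w\<close> in
    \<open>F\<close>; maximality in \<open>F\<close> gives \<open>w = m\<close>, hence
    \<open>- x\<close> is in \<open>CA\<close>.\<close>
  have "y - m - x \<notin> CB" if "x \<in> CA - {0}" for x
  proof
    assume "y - m - x \<in> CB"
    moreover have "m + x \<in> CA" using closed m(1) assms(3) that by auto
    ultimately obtain w where w: "w \<in> F" "w - (m + x) \<in> CA"
      using cofinal[of "m + x"] by (auto simp: algebra_simps)
    have "w - m \<in> CA" using closed(6)[OF w(2), of x] that by (simp add: algebra_simps)
    then have "w = m" using m(2) w(1) by blast
    then show False using opposite[of x] w(2) that CA_CB by simp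
  qed
  then show "\<exists>z. maximal_part y z"
    using m(1) assms(3,4) by (auto simp: maximal_part_def)
next
  fix z1 z2 assume max: "maximal_part y z1" "maximal_part y z2"
  have z: "z1 \<in> CA" "z2 \<in> CA" "y - z1 \<in> CB" "y - z2 \<in> CB" using max by (auto simp: maximal_part_def)
  have "\<exists>x\<in>F. nmul n (x - z1) + (x - z2) \<in> CA" for n
  proof -
    obtain w where w: "nmul (Suc n) w = nmul n z1 + z2" using divisible[of "Suc n"] by auto
    have "nmul (Suc n) (y - w) = nmul n (y - z1) + (y - z2)"
      by (simp only: nmul_diff w) (simp add: nmul_simps(2) nmul_diff algebra_simps)
    then have "y - w \<in> CB" using CB_nmul_iff[of "Suc n" "y - w"] z closed by simp
    moreover have "w \<in> CA" using CA_nmul_iff[of "Suc n" w] w z closed by simp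
    ultimately obtain x where x: "x \<in> F" "x - w \<in> CA" using cofinal by blast
    have "nmul (Suc n) (x - w) = nmul n (x - z1) + (x - z2)"
      by (simp only: nmul_diff w) (simp add: nmul_simps(2) nmul_diff algebra_simps)
    then show ?thesis using x closed(11)[OF x(2)] by metis
  qed
  then have "(\<Union>x\<in>F. {n. nmul n (x - z1) + (x - z2) \<in> CA}) = UNIV" by blast
  then obtain x where x: "x \<in> F" "infinite {n. nmul n (x - z1) + (x - z2) \<in> CA}"
    using assms(2) finite_UN[of F "\<lambda>x. {n. nmul n (x - z1) + (x - z2) \<in> CA}"] by auto
  then have "x - z1 \<in> CA" using CA_limit z assms(3) by blast
  then have "x = z1" using maximal_part_eqI[OF max(1)] x(1) assms(3,4) by blast
  \<comment> \<open>As \<open>x = z1\<close>, any such \<open>n\<close> turns the membership into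
    \<open>z1 - z2\<close> in \<open>CA\<close>, so \<open>z1\<close> dominates the maximal part
    \<open>z2\<close> as well.\<close>
  moreover obtain n where "nmul n (x - z1) + (x - z2) \<in> CA"
    using x(2) not_finite_existsD by auto
  ultimately show "z1 = z2" using maximal_part_eqI[OF max(2)] z by auto
qed

text \<open>Pseudo-saturation makes the finite set of divisors of \<open>M k y\<close> in
  \<open>A\<close> cofinal, where \<open>k\<close> clears the denominator of \<open>y\<close>;
  existence and uniqueness then descend from \<open>M k y\<close> to \<open>y\<close>.\<close>

lemma unique_maximal_parts_if_pseudo_saturated:
  assumes pseudo_saturated_pair
  shows unique_maximal_parts
  unfolding unique_maximal_parts_def
proof
  obtain M where M: "M \<ge> 1" and ps: "\<And>n x y. n \<ge> 1 \<Longrightarrow> x \<in> A \<Longrightarrow> y \<in> B \<Longrightarrow> nmul n y - x \<in> B \<Longrightarrow>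
      \<exists>x'\<in>A. nmul n x' - nmul M x \<in> A \<and> nmul M y - x' \<in> B"
    using assms unfolding pseudo_saturated_pair_def by blast
  fix y assume "y \<in> CB"
  then obtain k where k: "k \<ge> 1" "nmul k y \<in> B" by (auto simp: rat_closure_def)
  let ?y = "nmul k y" and ?F = "{x \<in> A. nmul M (nmul k y) - x \<in> B}"
  have "\<exists>!z. maximal_part (nmul M ?y) z"
  proof (rule ex1_maximal_part_if_cofinal[of _ ?F])
    show "nmul M ?y \<in> CB" using k closed B_CB by simp
    show "finite ?F" by (rule finite_divisors)
    show "?F \<subseteq> CA" using A_CA by blast
    show "nmul M ?y - x \<in> CB" if "x \<in> ?F" for x using that B_CB by blast
  next
    fix z assume z: "z \<in> CA" "nmul M ?y - z \<in> CB"
    \<comment> \<open>Dividing \<open>z\<close> by \<open>M\<close> compensates for the factor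
      \<open>M\<close> that pseudo-saturation attaches to \<open>x\<close>.\<close>
    obtain w where w: "nmul M w = z" using divisible[OF M] by blast
    have wC: "w \<in> CA" "?y - w \<in> CB"
      using z M by (auto simp: w[symmetric] CA_nmul_iff CB_nmul_iff nmul_diff[symmetric])
    then obtain n where n: "n \<ge> 1" "nmul n w \<in> A" by (auto simp: rat_closure_def)
    have "nmul n ?y - nmul n w \<in> B"
      using closed(10)[OF k(2), of n] n(2) A_subset_B closed(12)[OF wC(2), of n]
      by (intro saturated_B) (auto simp: nmul_diff)
    then obtain x where x: "x \<in> A" "nmul n x - nmul M (nmul n w) \<in> A" "nmul M ?y - x \<in> B"
      using ps[OF n k(2)] by blast
    have "nmul n (x - z) \<in> A" using x(2) by (simp add: nmul_diff w[symmetric] nmul_left_commute)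
    then have "x - z \<in> CA" using n(1) by (rule rat_closureI[rotated])
    then show "\<exists>x\<in>?F. x - z \<in> CA" using x by blast
  qed
  then show "\<exists>!z. maximal_part y z" using ex1_maximal_part_nmul[OF M] ex1_maximal_part_nmul[OF k(1)] by blast
qed

section \<open>Unique decompositions imply pseudo-saturation\<close>

text \<open>These are the points that occur as \<open>y'\<close> in minimal decompositions.\<close>

definition irreducible_points :: "'v set" where
  "irreducible_points = {c \<in> CB. maximal_part c 0}"

lemma irreducible_points_iff: "c \<in> irreducible_points \<longleftrightarrow> c \<in> CB \<and> (\<forall>x \<in> CA - {0}. c - x \<notin> CB)"
  using closed(5) by (auto simp: irreducible_points_def maximal_part_def)

lemma maximal_part_iff_irreducible:
  "maximal_part y z \<longleftrightarrow> z \<in> CA \<and> y - z \<in> irreducible_points"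
  by (auto simp: maximal_part_def irreducible_points_iff)

lemma irreducible_points_nmul: "n \<ge> 1 \<Longrightarrow> nmul n c \<in> irreducible_points \<longleftrightarrow> c \<in> irreducible_points"
  using maximal_part_nmul_iff[of n c 0] by (simp add: irreducible_points_def CB_nmul_iff)

text \<open>Anything in \<open>CA\<close> that splits off from \<open>a\<close> within
  \<open>CB\<close> also splits off from \<open>a + b\<close>; this is the face property.\<close>

lemma irreducible_points_summand:
  assumes "a + b \<in> irreducible_points" "a \<in> CB" "b \<in> CB"
  shows "a \<in> irreducible_points"
proof -
  have "a - x \<notin> CB" if "x \<in> CA - {0}" for x
  proof
    assume "a - x \<in> CB"
    then have "a + b - x \<in> CB" using closed(8)[of "a - x" b] assms(3) by (simp add: algebra_simps)
    then show False using assms(1) that by (auto simp: irreducible_points_iff)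
  qed
  then show ?thesis using assms(2) by (simp add: irreducible_points_iff)
qed

text \<open>The irreducible points form a union of faces of the cone; here \<open>I\<close> consists of the generators
  lying on the smallest face that contains \<open>c\<close>.\<close>

lemma irreducible_face:
  assumes "B = add_submonoid hull G" and "c \<in> B" and "c \<in> irreducible_points"
  obtains I where "I \<subseteq> G" "c \<in> add_submonoid hull I" "add_submonoid hull I \<subseteq> irreducible_points"
proof (rule that)
  let ?I = "{g \<in> G. \<exists>b \<in> add_submonoid hull G. c = g + b}"
  show "?I \<subseteq> G" by blast
  show "c \<in> add_submonoid hull ?I" using mem_hull_summands[of c G] assms(1,2) by simp
  \<comment> \<open>\<open>?T\<close> is the face of \<open>B\<close> generated by \<open>c\<close>:
    all elements dividing a positive multiple of \<open>c\<close>. It contains \<open>?I\<close> and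
    inherits irreducibility from the multiples of \<open>c\<close>.\<close>
  let ?T = "{d \<in> B. \<exists>n. n \<ge> 1 \<and> nmul n c - d \<in> B}"
  have "add_submonoid hull ?I \<subseteq> ?T"
  proof (rule hull_minimal)
    show "?I \<subseteq> ?T"
    proof
      fix g assume "g \<in> ?I"
      then obtain b where "g \<in> G" "b \<in> B" "c = g + b" using assms(1) by blast
      moreover from this have "g \<in> B" using assms(1) by (simp add: hull_inc)
      ultimately show "g \<in> ?T" by (auto intro!: exI[of _ 1])
    qed
    show "add_submonoid ?T"
    proof (rule add_submonoidI)
      show "0 \<in> ?T" using assms(2) closed by (auto intro!: exI[of _ 1])
    next
      fix d e assume "d \<in> ?T" "e \<in> ?T"
      then obtain m n where mn: "d \<in> B" "e \<in> B" "m \<ge> 1" "nmul m c - d \<in> B" "nmul n c - e \<in> B" by blast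
      have "nmul (m + n) c - (d + e) = (nmul m c - d) + (nmul n c - e)" by (simp add: nmul_add)
      then have "nmul (m + n) c - (d + e) \<in> B" using closed(4)[OF mn(4,5)] by metis
      moreover have "m + n \<ge> 1" using mn(3) by simp
      ultimately show "d + e \<in> ?T" using closed(4)[OF mn(1,2)] by blast
    qed
  qed
  moreover have "?T \<subseteq> irreducible_points"
  proof
    fix d assume "d \<in> ?T"
    then obtain n where n: "n \<ge> 1" "d \<in> B" "nmul n c - d \<in> B" by blast
    have "d + (nmul n c - d) \<in> irreducible_points"
      using irreducible_points_nmul[OF n(1)] assms(3) by simp
    then show "d \<in> irreducible_points" using n B_CB irreducible_points_summand by blast
  qed
  ultimately show "add_submonoid hull ?I \<subseteq> irreducible_points" by blast
qed

section \<open>Uniqueness yields greatest elements and bounded denominators\<close>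

context
  assumes unique: unique_maximal_parts
begin

text \<open>Both \<open>d\<close> and \<open>d'\<close> are maximal parts of the same element. Hence
  sums of a point of a face of irreducible points and a point of \<open>CA\<close> determine their
  summands.\<close>

lemma irreducible_decomposition_unique:
  assumes "c \<in> irreducible_points" "c' \<in> irreducible_points" "d \<in> CA" "d' \<in> CA" "c + d = c' + d'"
  shows "d = d'"
proof -
  have "maximal_part (c + d) d" "maximal_part (c + d) d'"
    using assms(1-4) unfolding maximal_part_iff_irreducible by (simp, simp add: assms(5))
  moreover have "c + d \<in> CB" using assms CA_CB closed by (simp add: irreducible_points_iff)
  ultimately show ?thesis using unique unfolding unique_maximal_parts_def by blast
qed

text \<open>If \<open>w\<close> is the maximal part of \<open>y - x\<close>, then subtracting
  \<open>w + x\<close> from \<open>y\<close> leaves the same irreducible point, so uniqueness gives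
  \<open>z = w + x\<close>. A unique maximal part is thus greatest.\<close>

lemma maximal_part_dominates:
  assumes "maximal_part y z" and "x \<in> CA" and "y - x \<in> CB"
  shows "z - x \<in> CA"
proof -
  obtain w where w: "maximal_part (y - x) w"
    using unique assms(3) unfolding unique_maximal_parts_def by blast
  then have "maximal_part y (w + x)"
    using assms(2) closed by (auto simp: maximal_part_iff_irreducible algebra_simps)
  moreover have "y \<in> CB" using closed(8)[OF assms(3) CA_CB[OF assms(2)]] by simp
  ultimately have "z = w + x" using unique assms(1) unfolding unique_maximal_parts_def by blast
  then show ?thesis using w by (simp add: maximal_part_def)
qed

text \<open>On the part of \<open>B\<close> lying over one face of irreducible points the maximal part is additive, so it
  is the projection of a direct sum, and the direct sum of the lattices has finite exponent in the
  ambient lattice.\<close>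

lemma maximal_part_denominator_face:
  assumes "finite G" and G: "B = add_submonoid hull G" and "add_submonoid hull I \<subseteq> irreducible_points"
  shows "\<exists>M\<ge>1. \<forall>y\<in>B. \<forall>z k. maximal_part y z \<longrightarrow> k \<ge> 1 \<longrightarrow>
    nmul k (y - z) \<in> add_submonoid hull I \<longrightarrow> nmul M z \<in> A"
proof -
  let ?L = "add_submonoid hull I"
  define T where "T = {c + d | c d. c \<in> ?L \<and> d \<in> A}"
  have subL: "add_submonoid ?L" by (rule add_submonoid_hull)
  have "add_submonoid T"
  proof (rule add_submonoidI)
    show "0 \<in> T" unfolding T_def using closed(1) add_submonoidD(1)[OF subL]
      by (intro CollectI exI[of _ 0]) simp
  next
    fix x y assume "x \<in> T" "y \<in> T"
    then obtain c d c' d' where "x = c + d" "y = c' + d'" "c \<in> ?L" "c' \<in> ?L" "d \<in> A" "d' \<in> A"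
      unfolding T_def by blast
    moreover from this have "x + y = (c + c') + (d + d')" by (simp add: ac_simps)
    ultimately show "x + y \<in> T"
      unfolding T_def using closed(2) add_submonoidD(2)[OF subL] by blast
  qed
  then have K: "add_subgroup (diff_group T)" by (rule add_subgroup_diff_group)
  have gB: "add_subgroup (diff_group B)" by (intro add_subgroup_diff_group submonoid_B)
  \<comment> \<open>\<open>H\<close> collects the elements of the lattice of \<open>B\<close> that
    are torsion modulo the lattice of \<open>T\<close>; finite generation gives one exponent
    \<open>M\<close> for all of them.\<close>
  define H where "H = {h \<in> diff_group B. \<exists>k\<ge>1. nmul k h \<in> diff_group T}"
  have "add_subgroup H"
    unfolding add_subgroup_def
  proof (intro conjI ballI)
    show "0 \<in> H" using add_subgroupD(1)[OF gB] add_subgroupD(1)[OF K] by (auto simp: H_def)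
  next
    fix x y assume "x \<in> H" "y \<in> H"
    then obtain k l where kl: "k \<ge> 1" "l \<ge> 1" "nmul k x \<in> diff_group T" "nmul l y \<in> diff_group T"
      and xy: "x \<in> diff_group B" "y \<in> diff_group B"
      by (auto simp: H_def)
    have "nmul (l * k) (x - y) = nmul l (nmul k x) - nmul k (nmul l y)"
      by (simp add: nmul_diff nmul_mult nmul_left_commute)
    then have "nmul (l * k) (x - y) \<in> diff_group T"
      using kl K by (simp add: add_subgroupD add_subgroup_nmul)
    then show "x - y \<in> H"
      using kl xy gB add_subgroupD(2)[OF gB] by (auto simp: H_def Suc_le_eq intro!: exI[of _ "l * k"])
  qed
  then obtain M where M: "M \<ge> 1" "\<And>h. h \<in> H \<Longrightarrow> nmul M h \<in> diff_group T"
    using torsion_exponent_bounded[OF assms(1), of H "diff_group T"] K unfolding H_def G by blast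
  have "nmul M z \<in> A" if y: "y \<in> B" "maximal_part y z" and k: "k \<ge> 1" "nmul k (y - z) \<in> ?L" for y z k
  proof -
    have "z \<in> CA" using y(2) by (simp add: maximal_part_def)
    then obtain l where l: "l \<ge> 1" "nmul l z \<in> A" by (auto simp: rat_closure_def)
    \<comment> \<open>The factor \<open>l * k\<close> moves \<open>y - z\<close> into the face and
      \<open>z\<close> into \<open>A\<close>.\<close>
    let ?c = "nmul (l * k) (y - z)" and ?d = "nmul (l * k) z"
    have c: "?c \<in> ?L" using add_submonoid_nmul[OF subL k(2), of l] by (simp add: nmul_mult)
    have d: "?d \<in> A" using closed(9)[OF l(2), of k] by (simp add: nmul_mult nmul_left_commute[of l])
    have "?c + ?d \<in> T" unfolding T_def using c d by blast
    then have "nmul (l * k) y \<in> T" by (simp add: nmul_diff)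
    then have "nmul (l * k) y - 0 \<in> diff_group T"
      unfolding diff_group_def using add_submonoidD(1)[OF \<open>add_submonoid T\<close>] by blast
    moreover have "y - 0 \<in> diff_group B" unfolding diff_group_def using y(1) closed(3) by blast
    ultimately have "y \<in> H" using k(1) l(1) by (auto simp: H_def Suc_le_eq intro!: exI[of _ "l * k"])
    then have "nmul M y \<in> diff_group T" by (rule M(2))
    then obtain c1 d1 c2 d2 where T: "nmul M y = (c1 + d1) - (c2 + d2)"
      "c1 \<in> ?L" "c2 \<in> ?L" "d1 \<in> A" "d2 \<in> A"
      unfolding diff_group_def T_def by blast
    let ?m = "l * k"
    have m: "?m \<ge> 1" using k l by (simp add: Suc_le_eq)
    have "nmul M ?c + nmul M ?d = nmul ?m (nmul M y)"
      by (simp add: nmul_diff nmul_left_commute[of M])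
    also have "\<dots> = nmul ?m c1 + nmul ?m d1 - (nmul ?m c2 + nmul ?m d2)"
      by (simp add: T(1) nmul_distribs)
    \<comment> \<open>Moving the negative terms across yields two decompositions with first summand
      in the face and second in \<open>CA\<close>; uniqueness equates the second summands.\<close>
    finally have eq: "(nmul M ?c + nmul ?m c2) + (nmul M ?d + nmul ?m d2) = nmul ?m c1 + nmul ?m d1"
      by (simp add: algebra_simps)
    have "nmul M ?c + nmul ?m c2 \<in> ?L" "nmul ?m c1 \<in> ?L"
      using T c subL by (auto intro!: add_submonoidD(2) add_submonoid_nmul)
    moreover have "nmul M ?d + nmul ?m d2 \<in> CA" "nmul ?m d1 \<in> CA"
      using T d closed A_CA by auto
    ultimately have "nmul M ?d + nmul ?m d2 = nmul ?m d1"
      using irreducible_decomposition_unique[OF _ _ _ _ eq] assms(3) by blast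
    then have "nmul ?m (nmul M z) = nmul ?m (d1 - d2)"
      by (simp add: nmul_diff nmul_left_commute[of M] algebra_simps)
    then have "nmul M z = d1 - d2" using nmul_inject[OF m] by blast
    then show ?thesis using saturated_A[OF T(4,5)] closed(11)[OF \<open>z \<in> CA\<close>, of M] by simp
  qed
  then show ?thesis using M(1) by blast
qed

text \<open>Only finitely many subsets of the generators span submonoids of irreducible points, so
  the product of their exponents works for all \<open>y\<close>.\<close>

lemma maximal_part_denominator:
  "\<exists>M\<ge>1. \<forall>y\<in>B. \<forall>z. maximal_part y z \<longrightarrow> nmul M z \<in> A"
proof -
  obtain G where G: "finite G" "B = add_submonoid hull G" using fg_B by (auto simp: fg_monoid_def)
  define \<I> where "\<I> = {I. I \<subseteq> G \<and> add_submonoid hull I \<subseteq> irreducible_points}"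
  have "finite \<I>" using G(1) by (simp add: \<I>_def)
  have "\<forall>I\<in>\<I>. \<exists>M\<ge>1. \<forall>y\<in>B. \<forall>z k. maximal_part y z \<longrightarrow> k \<ge> 1 \<longrightarrow>
      nmul k (y - z) \<in> add_submonoid hull I \<longrightarrow> nmul M z \<in> A"
    using maximal_part_denominator_face[OF G] by (simp add: \<I>_def)
  from bchoice[OF this] obtain m where m: "\<And>I. I \<in> \<I> \<Longrightarrow> m I \<ge> (1::nat)"
    "\<And>I y z k. I \<in> \<I> \<Longrightarrow> y \<in> B \<Longrightarrow> maximal_part y z \<Longrightarrow> k \<ge> 1 \<Longrightarrow>
      nmul k (y - z) \<in> add_submonoid hull I \<Longrightarrow> nmul (m I) z \<in> A"
    by blast
  have "nmul (prod m \<I>) z \<in> A" if y: "y \<in> B" "maximal_part y z" for y z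
  proof -
    have yz: "y - z \<in> irreducible_points" using y(2) by (simp add: maximal_part_iff_irreducible)
    then obtain k where k: "k \<ge> 1" "nmul k (y - z) \<in> B"
      by (auto simp: irreducible_points_iff rat_closure_def)
    have "nmul k (y - z) \<in> irreducible_points" using irreducible_points_nmul[OF k(1)] yz by simp
    then obtain I where "I \<subseteq> G" "nmul k (y - z) \<in> add_submonoid hull I"
      "add_submonoid hull I \<subseteq> irreducible_points"
      by (rule irreducible_face[OF G(2) k(2)])
    then have I: "I \<in> \<I>" "nmul k (y - z) \<in> add_submonoid hull I" by (simp_all add: \<I>_def)
    have "nmul (m I) z \<in> A" using m(2)[OF I(1) y k(1) I(2)] .
    moreover have "prod m \<I> = prod m (\<I> - {I}) * m I"
      using prod.remove[OF \<open>finite \<I>\<close> I(1), of m] by (simp add: mult.commute)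
    ultimately show ?thesis using closed(9) by (simp add: nmul_mult)
  qed
  moreover have "prod m \<I> \<ge> 1" using m(1) by (intro prod_ge_1) auto
  ultimately show ?thesis by blast
qed

text \<open>The required \<open>x'\<close> is \<open>M z\<close> with \<open>z\<close> the maximal
  part of \<open>y\<close>: since \<open>w = x / n\<close> lies below \<open>y\<close>, it lies
  below the greatest element \<open>z\<close>.\<close>

lemma pseudo_saturated_if_unique_maximal_parts: pseudo_saturated_pair
proof -
  obtain M where M: "M \<ge> 1" "\<And>y z. y \<in> B \<Longrightarrow> maximal_part y z \<Longrightarrow> nmul M z \<in> A"
    using maximal_part_denominator by blast
  have "\<exists>x'\<in>A. nmul n x' - nmul M x \<in> A \<and> nmul M y - x' \<in> B"
    if n: "n \<ge> 1" and x: "x \<in> A" and y: "y \<in> B" and xy: "nmul n y - x \<in> B" for n x y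
  proof -
    obtain w where w: "nmul n w = x" using divisible[OF n] by blast
    have wC: "w \<in> CA" "y - w \<in> CB"
      using w CA_nmul_iff[OF n, of w] CB_nmul_iff[OF n, of "y - w"] x xy A_CA B_CB
      by (auto simp: nmul_diff)
    obtain z where z: "maximal_part y z"
      using unique y B_CB unfolding unique_maximal_parts_def by blast
    have zA: "nmul M z \<in> A" using M(2) y z .
    have "nmul n (nmul M z) - nmul M x = nmul (n * M) (z - w)"
      by (simp add: w[symmetric] nmul_diff nmul_mult nmul_left_commute)
    then have "nmul n (nmul M z) - nmul M x \<in> A"
      using maximal_part_dominates[OF z wC] zA x by (intro saturated_A) (auto simp: closed)
    moreover have "nmul M y - nmul M z \<in> B"
      using z zA closed(10)[OF y, of M] A_subset_B closed(12)[of "y - z" M]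
      by (intro saturated_B) (auto simp: nmul_diff maximal_part_def)
    ultimately show ?thesis using zA by blast
  qed
  then show ?thesis using M(1) unfolding pseudo_saturated_pair_def by blast
qed

end

theorem pseudo_saturated_iff_unique_maximal_parts: "pseudo_saturated_pair \<longleftrightarrow> unique_maximal_parts"
  using unique_maximal_parts_if_pseudo_saturated pseudo_saturated_if_unique_maximal_parts by blast

end

section \<open>The lattice in the rationalized group envelope\<close>

lemma quotient_by_eq_iff:
  assumes "m \<ge> 1" "n \<ge> 1"
  shows "quotient_by a m = quotient_by b n \<longleftrightarrow> (\<exists>k\<ge>1. nmul (k * n) a = nmul (k * m) b)"
  using assms by transfer (simp add: frac_eq_def)

lemma quotient_by_cases:
  obtains a n where "n \<ge> 1" "v = quotient_by a n"
proof -
  have "\<exists>a n. n \<ge> 1 \<and> v = quotient_by a n"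
  proof (transfer, clarify)
    fix a :: 'a and m :: nat
    \<comment> \<open>The pair \<open>(a, m)\<close> means \<open>a / (m + 1)\<close>, while
      \<open>quotient_by\<close> takes the denominator itself, hence \<open>Suc m\<close>.\<close>
    have "frac_eq (a, m) (a, Suc m - 1)" by (auto simp: frac_eq_def)
    then show "\<exists>b n. n \<ge> 1 \<and> frac_eq (a, m) (b, n - 1)" by (intro exI[of _ a] exI[of _ "Suc m"]) simp
  qed
  then show thesis using that by blast
qed

lemma quotient_by_0 [simp]: "quotient_by 0 n = 0"
  by transfer (auto simp: frac_eq_def)

lemma quotient_by_add:
  assumes "n \<ge> 1"
  shows "quotient_by (a + b) n = quotient_by a n + quotient_by b n"
  using assms
proof transfer
  fix n :: nat and a b :: 'a
  assume "n \<ge> 1"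
  then obtain m where n: "n = Suc m" by (cases n) auto
  have S: "Suc (Suc i * Suc j - 1) = Suc i * Suc j" for i j by simp
  have "frac_eq (a + b, m) (nmul (Suc m) a + nmul (Suc m) b, Suc m * Suc m - 1)"
    unfolding frac_eq_def fst_conv snd_conv S
    by (intro exI[of _ 1]) (simp only: mult_1 nmul_mult nmul_simps(4) le_refl conj_absorb simp_thms)
  then show "frac_eq (a + b, n - 1)
      ((case (a, n - 1) of (a, m) \<Rightarrow> \<lambda>(b, n). (nmul (Suc n) a + nmul (Suc m) b, Suc m * Suc n - 1))
        (b, n - 1))"
    by (simp add: n)
qed

lemma nmul_quotient_by: "n \<ge> 1 \<Longrightarrow> nmul k (quotient_by a n) = quotient_by (nmul k a) n"
  using nmul_additive[of "\<lambda>a. quotient_by a n" k a] by (simp add: quotient_by_add)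

lemma rationalization_torsion_free:
  assumes "n \<ge> 1" and "nmul n v = 0"
  shows "v = (0 :: 'a::ab_group_add rationalization)"
proof -
  obtain a m where v: "m \<ge> 1" "v = quotient_by a m" by (rule quotient_by_cases)
  have "quotient_by (nmul n a) m = quotient_by 0 m"
    using assms(2) v by (simp add: nmul_quotient_by)
  then obtain k where k: "k \<ge> 1" "nmul (k * m) (nmul n a) = 0"
    unfolding quotient_by_eq_iff[OF v(1) v(1)] nmul_0(2) by blast
  have "nmul (k * n * m) a = nmul (k * n * m) 0"
    using k(2) by (simp add: nmul_mult[symmetric] ac_simps)
  then have "quotient_by a m = quotient_by 0 m"
    using k(1) assms(1) quotient_by_eq_iff[OF v(1) v(1), of a 0] by (metis mult_le_mono nat_mult_1)
  then show ?thesis by (simp add: v)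
qed

lemma nmul_quotient_by_cancel:
  assumes "n \<ge> 1" "m \<ge> 1"
  shows "nmul n (quotient_by a (n * m)) = quotient_by a m"
proof -
  have nm: "n * m \<ge> 1" using assms by (simp add: Suc_le_eq)
  have "quotient_by (nmul n a) (n * m) = quotient_by a m"
    unfolding quotient_by_eq_iff[OF nm assms(2)]
    by (intro exI[of _ 1]) (simp add: nmul_mult[symmetric] ac_simps)
  then show ?thesis by (simp add: nmul_quotient_by[OF nm])
qed

lemma rationalization_divisible:
  assumes "n \<ge> 1"
  shows "\<exists>w. nmul n w = (v :: 'a::ab_group_add rationalization)"
  using nmul_quotient_by_cancel[OF assms] by (metis quotient_by_cases)

text \<open>The locale is applied to images under this map, which carries abstract monoids into a
  rational vector space.\<close>

definition to_rat :: "'a::comm_monoid_add \<Rightarrow> 'a group_envelope rationalization" where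
  "to_rat x = quotient_by (to_envelope x) 1"

lemma to_envelope_0 [simp]: "to_envelope 0 = 0"
  by transfer (auto simp: gp_rel_def)

lemma to_envelope_add: "to_envelope (x + y) = to_envelope x + to_envelope y"
  by transfer (auto simp: gp_rel_def)

lemma to_rat_0 [simp]: "to_rat 0 = 0"
  by (simp add: to_rat_def)

lemma to_rat_add: "to_rat (x + y) = to_rat x + to_rat y"
  by (simp add: to_rat_def to_envelope_add quotient_by_add)

lemma to_rat_nmul: "to_rat (nmul n x) = nmul n (to_rat x)"
  by (rule nmul_additive) (simp_all add: to_rat_add)

text \<open>In a torsion-free group, \<open>v = x / n\<close> is equivalent to
  \<open>nmul n v = to_rat x\<close>.\<close>

lemma rat_cone_eq: "rat_cone M = rat_closure (to_rat ` M)"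
proof (intro equalityI subsetI)
  fix v assume "v \<in> rat_cone M"
  then obtain x n where x: "x \<in> M" "n \<ge> 1" "v = quotient_by (to_envelope x) n"
    by (auto simp: rat_cone_def)
  then have "nmul n v = to_rat x"
    using nmul_quotient_by_cancel[of n 1 "to_envelope x"] by (simp add: to_rat_def)
  then show "v \<in> rat_closure (to_rat ` M)" using x by (auto intro!: rat_closureI[of n])
next
  fix v assume "v \<in> rat_closure (to_rat ` M)"
  then obtain x n where x: "x \<in> M" "n \<ge> 1" "nmul n v = to_rat x"
    by (auto simp: rat_closure_def)
  then have "nmul n (v - quotient_by (to_envelope x) n) = 0"
    using nmul_quotient_by_cancel[of n 1 "to_envelope x"] by (simp add: to_rat_def nmul_diff)
  then have "v = quotient_by (to_envelope x) n"
    using rationalization_torsion_free[OF x(2)] by (metis eq_iff_diff_eq_0)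
  then show "v \<in> rat_cone M" using x by (auto simp: rat_cone_def)
qed

section \<open>Integrality and saturation seen in the ambient group\<close>

lemma gp_diff_eq_iff:
  assumes "add_submonoid M" "a \<in> M" "b \<in> M" "c \<in> M" "d \<in> M"
  shows "gp_diff M a b = gp_diff M c d \<longleftrightarrow> (\<exists>k\<in>M. a + d + k = c + b + k)"
proof -
  have "gp_diff M a b = gp_diff M c d \<longleftrightarrow> ((a, b), (c, d)) \<in> gp_rel M"
    unfolding gp_diff_def using assms(2-) by (intro eq_equiv_class_iff[OF equiv_gp_rel[OF assms(1)]]) auto
  then show ?thesis using assms(2-) by (simp add: gp_rel_def)
qed

text \<open>Integrality makes the map to the envelope injective; torsion-freeness keeps it injective
  after rationalization.\<close>

lemma inj_to_rat:
  assumes "integral_monoid (UNIV :: 'a::comm_monoid_add set)"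
    and "torsion_free_monoid (UNIV :: 'a set)"
  shows "inj (to_rat :: 'a \<Rightarrow> _)"
proof (rule injI)
  fix x y :: 'a
  have U: "add_submonoid (UNIV :: 'a set)" by (simp add: add_submonoid_def)
  have cancel: "a = b" if "a + k = b + k" for a b k :: 'a
  proof -
    have "gp_incl UNIV a = gp_incl UNIV b"
      unfolding gp_incl_def using that by (subst gp_diff_eq_iff[OF U]) auto
    then show ?thesis using assms(1) by (auto simp: integral_monoid_def dest: injD)
  qed
  assume "to_rat x = to_rat y"
  then have "\<exists>k\<ge>1. nmul (k * 1) (to_envelope x) = nmul (k * 1) (to_envelope y)"
    unfolding to_rat_def by (rule quotient_by_eq_iff[THEN iffD1, rotated 2]) (rule le_refl)+
  then obtain k where k: "k \<ge> 1" "nmul k (to_envelope x) = nmul k (to_envelope y)"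
    unfolding mult_1_right by blast
  then have "to_envelope (nmul k x) = to_envelope (nmul k y)"
    using nmul_additive[of to_envelope, OF to_envelope_0 to_envelope_add] by metis
  then have "nmul k x = nmul k y"
    by transfer (auto simp: gp_rel_def intro: cancel)
  then have "gp_diff UNIV (nmul k x) (nmul k y) = gp_incl UNIV 0"
    unfolding gp_incl_def by (subst gp_diff_eq_iff[OF U]) auto
  then have "gp_diff UNIV x y = gp_incl UNIV 0"
    using assms(2) k(1) unfolding torsion_free_monoid_def by blast
  then show "x = y"
    unfolding gp_incl_def by (subst (asm) gp_diff_eq_iff[OF U]) (auto dest: cancel)
qed

text \<open>Saturation of \<open>M\<close> is stated in its own envelope. Injectivity turns
  \<open>n (u - v)\<close> in the image into an equation inside \<open>M\<close>, saturation is
  applied there, and the result is mapped back.\<close>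

lemma saturated_to_rat_image:
  assumes "inj (to_rat :: 'a::comm_monoid_add \<Rightarrow> _)" and "add_submonoid M" and "saturated_monoid M"
    and "u \<in> to_rat ` M" "v \<in> to_rat ` M" "u - v \<in> rat_closure (to_rat ` (M :: 'a set))"
  shows "u - v \<in> to_rat ` M"
proof -
  obtain a b where ab: "a \<in> M" "b \<in> M" "u = to_rat a" "v = to_rat b" using assms(4,5) by blast
  obtain n c where c: "n \<ge> 1" "c \<in> M" "nmul n (u - v) = to_rat c"
    using assms(6) by (auto simp: rat_closure_def)
  have "to_rat (nmul n a) = to_rat (c + nmul n b)"
    using c(3) by (simp add: ab to_rat_add to_rat_nmul nmul_diff algebra_simps)
  then have eq: "nmul n a = c + nmul n b" using assms(1) by (auto dest: injD)
  have "gp_diff M (nmul n a) (nmul n b) = gp_incl M c"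
    unfolding gp_incl_def
  proof (subst gp_diff_eq_iff)
    show "\<exists>k\<in>M. nmul n a + 0 + k = c + nmul n b + k"
      using eq add_submonoidD(1)[OF assms(2)] by auto
  qed (use ab(1,2) c(2) assms(2) in \<open>auto intro: add_submonoid_nmul add_submonoidD(1)\<close>)
  then have "gp_diff M a b \<in> gp_incl M ` M"
    using assms(3) ab c unfolding saturated_monoid_def by blast
  then obtain c' where c': "c' \<in> M" "gp_diff M a b = gp_diff M c' 0"
    by (auto simp: gp_incl_def)
  then obtain k where "a + 0 + k = c' + b + k"
    using gp_diff_eq_iff[OF assms(2)] ab add_submonoidD(1)[OF assms(2)] by metis
  \<comment> \<open>The auxiliary summand \<open>k\<close> cancels because the target is a
    group.\<close>
  then have "to_rat (a + 0 + k) = to_rat (c' + b + k)" by (rule arg_cong)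
  then have "u - v = to_rat c'" by (simp add: to_rat_add ab algebra_simps)
  then show ?thesis using c'(1) by blast
qed

theorem theorem1p3:
  fixes P :: "'q::comm_monoid_add set"
  assumes "torsion_free_monoid (UNIV :: 'q set)"
    and "fs_monoid (UNIV :: 'q set)"
    and "add_submonoid P"
    and "toric_monoid P"
    and "range to_envelope \<inter> uminus ` to_envelope ` P = {0}"
  shows "pseudo_saturated P (UNIV :: 'q set) (\<lambda>x. x) \<longleftrightarrow>
    (\<forall>y \<in> rat_cone (UNIV :: 'q set). \<exists>!d. minimal_decomposition P UNIV y d)"
proof -
  have sat: "saturated_monoid P" "saturated_monoid (UNIV :: 'q set)"
    and fg: "fg_monoid P" "fg_monoid (UNIV :: 'q set)"
    using assms(2,4) by (auto simp: toric_monoid_def fs_monoid_def)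
  have U: "add_submonoid (UNIV :: 'q set)" by (simp add: add_submonoid_def)
  have inj: "inj (to_rat :: 'q \<Rightarrow> _)"
    using inj_to_rat assms(1) sat(2) unfolding saturated_monoid_def by blast
  interpret saturated_pair "to_rat ` P" "range (to_rat :: 'q \<Rightarrow> _)"
  proof
    show "nmul n v = 0 \<Longrightarrow> v = 0" "\<exists>w. nmul n w = v"
      if "n \<ge> 1" for n and v :: "'q group_envelope rationalization"
      using rationalization_torsion_free[OF that] rationalization_divisible[OF that] by auto
    show "to_rat ` P \<subseteq> range to_rat" by blast
    show "fg_monoid (to_rat ` P)" "fg_monoid (range (to_rat :: 'q \<Rightarrow> _))"
      by (intro fg_monoid_image fg to_rat_add to_rat_0)+
  next
    fix v :: "'q group_envelope rationalization"
    assume "v \<in> rat_closure (range to_rat)" "- v \<in> rat_closure (to_rat ` P)"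
    then obtain m n q p where mn: "m \<ge> 1" "n \<ge> 1" "p \<in> P" "nmul m v = to_rat q" "nmul n (- v) = to_rat p"
      by (auto simp: rat_closure_def)
    \<comment> \<open>Clearing both denominators turns opposite rational points into opposite
      elements of \<open>Q\<close> and \<open>P\<close>, to which the hypothesis applies.\<close>
    have "to_rat (nmul n q + nmul m p) = to_rat 0"
      by (simp add: to_rat_add to_rat_nmul mn(4,5)[symmetric] nmul_uminus nmul_left_commute[of n m])
    then have "nmul n q + nmul m p = 0" by (rule injD[OF inj])
    then have "to_envelope (nmul n q) = - to_envelope (nmul m p)"
      using to_envelope_add[of "nmul n q" "nmul m p"] by (simp add: eq_neg_iff_add_eq_0)
    moreover have "nmul m p \<in> P" using add_submonoid_nmul assms(3) mn(3) .
    ultimately have "to_envelope (nmul n q) \<in> range to_envelope \<inter> uminus ` to_envelope ` P" by blast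
    then have "to_rat (nmul n q) = 0" using assms(5) by (simp add: to_rat_def)
    then have "nmul (n * m) v = 0" by (simp add: to_rat_nmul nmul_mult mn(4))
    then show "v = 0" using mn(1,2) rationalization_torsion_free[of "n * m" v] by (simp add: Suc_le_eq)
  qed (fact saturated_to_rat_image[OF inj assms(3) sat(1)] saturated_to_rat_image[OF inj U sat(2)])+
  have mdvd: "mdvd M x y \<longleftrightarrow> to_rat y - to_rat x \<in> to_rat ` M" for M and x y :: 'q
  proof -
    have "y = x + z \<longleftrightarrow> to_rat y - to_rat x = to_rat z" for z
      using inj_eq[OF inj, of y "x + z"] unfolding to_rat_add diff_eq_eq by (simp only: add.commute)
    then show ?thesis by (auto simp: mdvd_def image_iff)
  qed
  have "pseudo_saturated P (UNIV :: 'q set) (\<lambda>x. x) \<longleftrightarrow> pseudo_saturated_pair"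
    unfolding pseudo_saturated_def pseudo_saturated_pair_def mdvd
    by (simp add: to_rat_nmul)
  moreover have "(\<exists>!d. minimal_decomposition P UNIV y d) \<longleftrightarrow> (\<exists>!z. maximal_part y z)" for y
  proof -
    \<comment> \<open>The first component is forced to be \<open>y - z\<close>, so unique pairs and
      unique \<open>z\<close> amount to the same.\<close>
    have *: "minimal_decomposition P UNIV y (y', z) \<longleftrightarrow> y' = y - z \<and> maximal_part y z" for y' z
      unfolding minimal_decomposition_def maximal_part_def rat_cone_eq by auto
    show ?thesis
    proof
      assume "\<exists>!d. minimal_decomposition P UNIV y d"
      then obtain y' z where d: "minimal_decomposition P UNIV y (y', z)"
        and u: "\<And>d. minimal_decomposition P UNIV y d \<Longrightarrow> d = (y', z)" by auto
      show "\<exists>!z. maximal_part y z"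
      proof
        show "maximal_part y z" using d * by blast
        show "w = z" if "maximal_part y w" for w using u[of "(y - w, w)"] that * by simp
      qed
    next
      assume "\<exists>!z. maximal_part y z"
      then obtain z where z: "maximal_part y z" "\<And>w. maximal_part y w \<Longrightarrow> w = z" by blast
      show "\<exists>!d. minimal_decomposition P UNIV y d"
      proof
        show "minimal_decomposition P UNIV y (y - z, z)" using z * by blast
        show "d = (y - z, z)" if "minimal_decomposition P UNIV y d" for d
          using that z(2) * by (cases d) auto
      qed
    qed
  qed
  ultimately show ?thesis
    using pseudo_saturated_iff_unique_maximal_parts
    unfolding unique_maximal_parts_def rat_cone_eq by simp
qed

end
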